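(* Let $b\ge2$ and $k\ge2$ be integers and let $S$ be a finite, non-empty set of prime numbers. Then there exist effectively computable positive numbers $c_1$ and $j_1$, depending only on $b$, $k$ and $S$, such that $$[u_j^{(k)}]_S\le (u_j^{(k)})^{1-c_1}\quad\text{for every } j\ge j_1.$$
   Context: For integers $b\ge2$ and $k\ge2$, $(u_j^{(k)})_{j\ge1}$ denotes the sequence, arranged in increasing order, of all positive integers not divisible by $b$ having at most $k$ nonzero digits in their base-$b$ representation; equivalently, the integers $1,2,\dots,b-1$ together with those of the form $d_kb^{n_k}+\cdots+d_2b^{n_2}+d_1$ with $n_k>\cdots>n_2>0$, $d_1,\dots,d_k\in\{0,1,\dots,b-1\}$ and $d_1d_k\neq0$. For a finite set $S=\{q_1,\dots,q_s\}$ of primes and a positive integer $n=Aq_1^{r_1}\cdots q_s^{r_s}$ with $r_i\ge0$ and $A$ coprime to $q_1\cdots q_s$, the $S$-part of $n$ is $[n]_S:=q_1^{r_1}\cdots q_s^{r_s}$. *)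

theory Defs
  imports Complex_Main "HOL-Library.Infinite_Set" "HOL-Library.Nat_Bijection"
    "HOL-Computational_Algebra.Primes"
begin

definition digit :: "nat \<Rightarrow> nat \<Rightarrow> nat \<Rightarrow> nat" where
  "digit b n i = (n div b ^ i) mod b"

definition sparse_set :: "nat \<Rightarrow> nat \<Rightarrow> nat set" where
  "sparse_set b k = {n. n > 0 \<and> \<not> b dvd n \<and> card {i. digit b n i \<noteq> 0} \<le> k}"

text \<open>The sequence is indexed from 1, whereas \<^const>\<open>enumerate\<close> starts at 0;
  the value at \<open>j = 0\<close> is meaningless.\<close>

definition u :: "nat \<Rightarrow> nat \<Rightarrow> nat \<Rightarrow> nat" where
  "u b k j = enumerate (sparse_set b k) (j - 1)"

definition S_part :: "nat set \<Rightarrow> nat \<Rightarrow> nat" where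
  "S_part S n = (\<Prod>q\<in>S. q ^ multiplicity q n)"

text \<open>The next three facts show that the totalised library functions used above have their
  intended meaning: the cardinality is that of a finite set, the enumerated set is infinite,
  and the \<open>S\<close>-part is the one read off from any factorisation \<open>A * (\<Prod>q\<in>S. q ^ r q)\<close>
  with \<open>A\<close> coprime to the primes in \<open>S\<close>.\<close>

lemma finite_nonzero_digits:
  assumes "b \<ge> 2"
  shows "finite {i. digit b n i \<noteq> 0}"
proof (rule finite_subset)
  show "{i. digit b n i \<noteq> 0} \<subseteq> {..n}"
  proof
    fix i assume i: "i \<in> {i. digit b n i \<noteq> 0}"
    have "i < b ^ i"
      using assms by (intro power_gt_expt) auto
    moreover have "b ^ i \<le> n"
      using i by (cases "n < b ^ i") (simp_all add: digit_def)
    ultimately show "i \<in> {..n}" by simp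
  qed
qed simp

lemma infinite_sparse_set:
  assumes b: "b \<ge> 2" and k: "k \<ge> 2"
  shows "infinite (sparse_set b k)"
proof -
  have mem: "b ^ Suc m + 1 \<in> sparse_set b k" for m
  proof -
    have "{i. digit b (b ^ Suc m + 1) i \<noteq> 0} \<subseteq> {0, Suc m}"
    proof (rule subsetI, rule ccontr)
      fix i assume "i \<in> {i. digit b (b ^ Suc m + 1) i \<noteq> 0}" and "i \<notin> {0, Suc m}"
      then have nz: "digit b (b ^ Suc m + 1) i \<noteq> 0" and i: "i \<noteq> 0" "i \<noteq> Suc m" by auto
      have one: "1 < b ^ i" using b i by (intro one_less_power) auto
      show False
      proof (cases "i < Suc m")
        case True
        then obtain d where d: "Suc m = i + Suc d"
          using less_imp_Suc_add[of i "Suc m"] by auto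
        have "(b ^ Suc m + 1) div b ^ i = b ^ Suc d"
        proof -
          have "b ^ Suc m + 1 = 1 + b ^ Suc d * b ^ i"
            by (simp only: d power_add ac_simps)
          also have "\<dots> div b ^ i = b ^ Suc d + 1 div b ^ i"
            by (rule div_mult_self1) (use b in simp)
          also have "1 div b ^ i = 0" using one by (rule div_less)
          finally show ?thesis by simp
        qed
        then show False using nz by (simp add: digit_def)
      next
        case False
        with i have "Suc (Suc m) \<le> i" by simp
        then have "b ^ Suc (Suc m) \<le> b ^ i"
          using b by (intro power_increasing) auto
        moreover have "2 * b ^ Suc m \<le> b ^ Suc (Suc m)"
          using b by simp
        moreover have "1 < b ^ Suc m" using b by (intro one_less_power) auto
        ultimately have "b ^ Suc m + 1 < b ^ i" by linarith
        then show False using nz by (simp add: digit_def)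
      qed
    qed
    then have "card {i. digit b (b ^ Suc m + 1) i \<noteq> 0} \<le> card {0, Suc m}"
      by (intro card_mono) auto
    moreover have "\<not> b dvd b ^ Suc m + 1"
      using b dvd_add_right_iff[of b "b ^ Suc m" 1] by simp
    ultimately show ?thesis using k by (simp add: sparse_set_def)
  qed
  have "inj (\<lambda>m. b ^ Suc m + 1)"
    using b by (auto intro!: injI)
  then have "infinite (range (\<lambda>m. b ^ Suc m + 1))"
    by (rule range_inj_infinite)
  moreover have "range (\<lambda>m. b ^ Suc m + 1) \<subseteq> sparse_set b k"
    using mem by blast
  ultimately show ?thesis using finite_subset by blast
qed

lemma S_part_eq:
  fixes A :: nat and r :: "nat \<Rightarrow> nat"
  assumes S: "finite S" "\<And>q. q \<in> S \<Longrightarrow> prime q"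
    and n: "n > 0" "n = A * (\<Prod>q\<in>S. q ^ r q)" and A: "coprime A (\<Prod>S)"
  shows "S_part S n = (\<Prod>q\<in>S. q ^ r q)"
proof -
  have "multiplicity q n = r q" if q: "q \<in> S" for q
  proof -
    have pr: "prime q" using S q by simp
    have "q dvd \<Prod>S" using S(1) q by (rule dvd_prod_eqI) simp
    then have "\<not> q dvd A"
      using A pr coprime_common_divisor[of A "\<Prod>S" q] not_prime_unit[of q] by blast
    moreover have "\<not> q dvd (\<Prod>p\<in>S - {q}. p ^ r p)"
    proof
      assume "q dvd (\<Prod>p\<in>S - {q}. p ^ r p)"
      then obtain p where "p \<in> S - {q}" "q dvd p ^ r p"
        using S(1) pr by (auto simp: prime_dvd_prod_iff)
      then show False
        using S(2)[of p] pr prime_dvd_power[of q p "r p"] primes_dvd_imp_eq[of q p] by auto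
    qed
    ultimately have nd: "\<not> q dvd A * (\<Prod>p\<in>S - {q}. p ^ r p)"
      using pr by (simp add: prime_dvd_mult_iff)
    have "n = q ^ r q * (A * (\<Prod>p\<in>S - {q}. p ^ r p))"
      unfolding n(2) prod.remove[OF S(1) q] by (simp only: mult_ac)
    moreover have "\<not> q ^ Suc (r q) dvd q ^ r q * (A * (\<Prod>p\<in>S - {q}. p ^ r p))"
      using nd prime_gt_0_nat[OF pr] by (simp add: mult.commute[of q])
    ultimately show ?thesis
      by (intro multiplicity_eqI) simp_all
  qed
  then show ?thesis by (simp add: S_part_def)
qed

text \<open>Total recursive functions of a given arity, after Kleene: the least class containing the
  zero functions, the successor and the projections, and closed under composition, primitive
  recursion and minimisation of regular functions. Arguments are passed as a list; only lists
  whose length is the arity matter.\<close>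

inductive total_recursive :: "nat \<Rightarrow> (nat list \<Rightarrow> nat) \<Rightarrow> bool" where
  zero: "total_recursive n (\<lambda>xs. 0)"
| succ: "total_recursive 1 (\<lambda>xs. Suc (xs ! 0))"
| proj: "i < n \<Longrightarrow> total_recursive n (\<lambda>xs. xs ! i)"
| comp: "total_recursive (length gs) f \<Longrightarrow> (\<And>g. g \<in> set gs \<Longrightarrow> total_recursive n g)
    \<Longrightarrow> total_recursive n (\<lambda>xs. f (map (\<lambda>g. g xs) gs))"
| prec: "total_recursive n f \<Longrightarrow> total_recursive (Suc (Suc n)) g
    \<Longrightarrow> total_recursive (Suc n)
          (\<lambda>xs. rec_nat (f (tl xs)) (\<lambda>i r. g (i # r # tl xs)) (hd xs))"
| mini: "total_recursive (Suc n) f \<Longrightarrow> (\<And>xs. length xs = n \<Longrightarrow> \<exists>y. f (y # xs) = 0)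
    \<Longrightarrow> total_recursive n (\<lambda>xs. LEAST y. f (y # xs) = 0)"

text \<open>Effective computability of a number depending on \<open>b\<close>, \<open>k\<close> and a finite set \<open>S\<close>: a single
  algorithm produces it from these data, \<open>S\<close> being given by its canonical code
  \<open>set_encode S = (\<Sum>q\<in>S. 2 ^ q)\<close>. For a real number, the algorithm produces dyadic
  approximations to within \<open>1 / 2 ^ n\<close>, written as differences of naturals to allow any sign.\<close>

definition effectively_computable_nat :: "(nat \<Rightarrow> nat \<Rightarrow> nat set \<Rightarrow> nat) \<Rightarrow> bool" where
  "effectively_computable_nat F \<longleftrightarrow>
    (\<exists>f. total_recursive 3 f \<and>
      (\<forall>b k S. finite S \<longrightarrow> F b k S = f [b, k, set_encode S]))"

definition effectively_computable_real :: "(nat \<Rightarrow> nat \<Rightarrow> nat set \<Rightarrow> real) \<Rightarrow> bool" where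
  "effectively_computable_real F \<longleftrightarrow>
    (\<exists>f g. total_recursive 4 f \<and> total_recursive 4 g \<and>
      (\<forall>b k S n. finite S \<longrightarrow>
        \<bar>F b k S - (real (f [b, k, set_encode S, n]) - real (g [b, k, set_encode S, n])) / 2 ^ n\<bar>
          \<le> 1 / 2 ^ n))"

end

theory Submission
  imports Defs "HOL-Analysis.Kronecker_Approximation_Theorem" "HOL-Library.Log_Nat"
    "Jordan_Normal_Form.Determinant"
begin

text \<open>
  If \<open>n\<close> has at most \<open>k\<close> nonzero digits, then by pigeonhole one of \<open>k\<close> rapidly growing ranges of
  positions (counted from the top) contains none of them, so \<open>n = D * b ^ W + r\<close> where \<open>D\<close> is much
  shorter than the gap between \<open>r\<close> and \<open>b ^ W\<close>. If moreover \<open>n = A * [n]\<^sub>S\<close> with \<open>A\<close> small, then the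
  linear form \<open>\<Lambda> = ln n - ln (D * b ^ W)\<close> in \<open>ln (A / D)\<close>, \<open>ln b\<close> and the \<open>ln q\<close> for \<open>q \<in> S\<close>, in which
  \<open>A / D\<close> occurs with exponent one, is nonzero but very small.

  Such a form is bounded below by a trick of Bombieri: simultaneous Dirichlet approximation of the
  exponents rewrites it as \<open>\<Lambda> = ln a - N * ln \<xi>\<close> with rational \<open>a\<close> and \<open>\<xi>\<close>, where \<open>\<xi>\<close> has bounded
  height, \<open>a\<close> has height much smaller than \<open>exp N\<close>, and \<open>\<xi>\<close> is close to \<open>1\<close>. The resulting two-logarithm
  form is treated by Laurent's interpolation determinants. The determinant of the values of
  \<open>x choose k * \<xi> ^ (l * x)\<close>, with \<open>\<xi> ^ (r + s * N)\<close> replaced by the nearly equal \<open>\<xi> ^ r * a ^ s\<close>, at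
  points \<open>x = r + s * N\<close> is a nonzero rational number of controlled denominator, while the binomial
  expansion of \<open>(1 + (\<xi> ^ l - 1)) ^ x\<close> shows that it is very small; no complex analysis is needed.
  All constants are explicit.
\<close>

section \<open>Interpolation determinants\<close>

lemma permutes_less:
  "\<pi> permutes {0..<T} \<Longrightarrow> i < T \<Longrightarrow> \<pi> i < T" for T :: nat
  using permutes_in_image[of \<pi> "{0..<T}" i] by simp

text \<open>Multilinearity in the columns, with \<open>g\<close> choosing one summand for each
  column. The determinant is transposed first so that the product in the Leibniz formula runs over
  the columns and can be expanded.\<close>

lemma det_expand_columns:
  fixes V c :: "nat \<Rightarrow> nat \<Rightarrow> real"
  assumes I: "finite I"
  shows "det (mat T T (\<lambda>(i, j). \<Sum>n\<in>I. V i n * c n j))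
    = (\<Sum>g\<in>{0..<T} \<rightarrow>\<^sub>E I. (\<Prod>j = 0..<T. c (g j) j) * det (mat T T (\<lambda>(i, j). V i (g j))))"
proof -
  have "det (mat T T (\<lambda>(i, j). \<Sum>n\<in>I. V i n * c n j))
      = det (mat T T (\<lambda>(j, i). \<Sum>n\<in>I. V i n * c n j))"
    by (subst det_transpose[symmetric, of _ T]) (auto intro!: arg_cong[where f = det])
  also have "\<dots> = (\<Sum>\<pi> | \<pi> permutes {0..<T}. signof \<pi> * (\<Prod>j = 0..<T. \<Sum>n\<in>I. V (\<pi> j) n * c n j))"
    by (subst det_def'[of _ T])
      (auto intro!: sum.cong prod.cong simp: permutes_less)
  also have "\<dots> = (\<Sum>\<pi> | \<pi> permutes {0..<T}. \<Sum>g\<in>{0..<T} \<rightarrow>\<^sub>E I.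
      signof \<pi> * (\<Prod>j = 0..<T. V (\<pi> j) (g j) * c (g j) j))"
    by (subst prod_sum_PiE) (auto simp: I sum_distrib_left)
  also have "\<dots> = (\<Sum>g\<in>{0..<T} \<rightarrow>\<^sub>E I. (\<Prod>j = 0..<T. c (g j) j) *
      (\<Sum>\<pi> | \<pi> permutes {0..<T}. signof \<pi> * (\<Prod>j = 0..<T. V (\<pi> j) (g j))))"
    by (subst sum.swap) (simp add: prod.distrib sum_distrib_left mult_ac)
  also have "\<dots> = (\<Sum>g\<in>{0..<T} \<rightarrow>\<^sub>E I. (\<Prod>j = 0..<T. c (g j) j) * det (mat T T (\<lambda>(i, j). V i (g j))))"
  proof (intro sum.cong refl arg_cong2[where f = "(*)"])
    fix g
    have "det (mat T T (\<lambda>(i, j). V i (g j))) = det (mat T T (\<lambda>(j, i). V i (g j)))"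
      by (subst det_transpose[symmetric, of _ T]) (auto intro!: arg_cong[where f = det])
    then show "(\<Sum>\<pi> | \<pi> permutes {0..<T}. signof \<pi> * (\<Prod>j = 0..<T. V (\<pi> j) (g j)))
      = det (mat T T (\<lambda>(i, j). V i (g j)))"
      by (subst (asm) (2) det_def'[of _ T]) (auto intro!: sum.cong prod.cong simp: permutes_less)
  qed
  finally show ?thesis .
qed

lemma abs_det_le:
  fixes V :: "nat \<Rightarrow> nat \<Rightarrow> real"
  assumes "\<And>i j. i < T \<Longrightarrow> j < T \<Longrightarrow> \<bar>V i j\<bar> \<le> v j"
  shows "\<bar>det (mat T T (\<lambda>(i, j). V i j))\<bar> \<le> fact T * (\<Prod>j = 0..<T. v j)"
proof -
  have "\<bar>det (mat T T (\<lambda>(i, j). V i j))\<bar>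
      \<le> (\<Sum>\<pi> | \<pi> permutes {0..<T}. \<bar>signof \<pi> * (\<Prod>i = 0..<T. V i (\<pi> i))\<bar>)"
  proof -
    have "det (mat T T (\<lambda>(i, j). V i j))
        = (\<Sum>\<pi> | \<pi> permutes {0..<T}. signof \<pi> * (\<Prod>i = 0..<T. V i (\<pi> i)))"
      by (subst det_def'[of _ T]) (auto intro!: sum.cong prod.cong simp: permutes_less)
    then show ?thesis by (simp only: sum_abs)
  qed
  also have "\<dots> \<le> (\<Sum>\<pi> | \<pi> permutes {0..<T}. \<Prod>j = 0..<T. v j)"
  proof (rule sum_mono)
    fix \<pi> assume "\<pi> \<in> {\<pi>. \<pi> permutes {0..<T}}"
    then have p: "\<pi> permutes {0..<T}" by simp
    have "\<bar>signof \<pi> * (\<Prod>i = 0..<T. V i (\<pi> i))\<bar> = (\<Prod>i = 0..<T. \<bar>V i (\<pi> i)\<bar>)"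
      by (simp add: abs_mult abs_prod sign_def)
    also have "\<dots> \<le> (\<Prod>i = 0..<T. v (\<pi> i))"
      using p by (intro prod_mono) (auto intro!: assms simp: permutes_less)
    also have "\<dots> = (\<Prod>j = 0..<T. v j)"
      using prod.permute[OF p, of v] by (simp add: comp_def)
    finally show "\<bar>signof \<pi> * (\<Prod>i = 0..<T. V i (\<pi> i))\<bar> \<le> (\<Prod>j = 0..<T. v j)" .
  qed
  also have "\<dots> = fact T * (\<Prod>j = 0..<T. v j)"
    by (simp add: card_permutations)
  finally show ?thesis .
qed

text \<open>Remove the maximum: the largest of \<open>m + 1\<close> naturals is at least
  \<open>m\<close>. The cut at \<open>T\<close> costs nothing while the cardinality is at most
  \<open>T\<close>; thanks to it, a summand with a very large index is later charged only
  \<open>E ^ T\<close>.\<close>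

lemma sum_min_card_ge:
  assumes "finite A" and "card A \<le> T"
  shows "(\<Sum>i<card A. i) \<le> (\<Sum>n\<in>A. min n T)"
  using assms
proof (induction "card A" arbitrary: A)
  case (Suc m)
  let ?M = "Max A"
  have A: "finite A" "A \<noteq> {}" using Suc by auto
  have M: "?M \<in> A" using A by simp
  have c: "card (A - {?M}) = m" using Suc M by (simp add: card_Diff_singleton)
  have "A \<subseteq> {..?M}" using A by auto
  then have "card A \<le> Suc ?M" by (metis card_atMost card_mono finite_atMost)
  then have mM: "m \<le> min ?M T" using Suc by auto
  moreover have "(\<Sum>i<m. i) \<le> (\<Sum>n\<in>A - {?M}. min n T)"
    using Suc.hyps(1)[of "A - {?M}"] Suc.prems Suc.hyps(2) c by simp
  ultimately have "(\<Sum>i<Suc m. i) \<le> min ?M T + (\<Sum>n\<in>A - {?M}. min n T)"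
    using add_mono[OF mM] by (simp add: add.commute del: min.bounded_iff)
  then show ?case using sum.remove[OF A(1) M, of "\<lambda>n. min n T"] Suc.hyps(2) by simp
qed simp

text \<open>Only injective choices of one summand per column survive the multilinear expansion, and
  \<open>T\<close> distinct indices have a total weight of at least \<open>0 + 1 + \<dots> + (T - 1)\<close>.\<close>

lemma det_weighted_bound:
  fixes V c :: "nat \<Rightarrow> nat \<Rightarrow> real" and v :: "nat \<Rightarrow> real" and E :: real
  assumes I: "finite I" and E: "E \<ge> 1"
    and V: "\<And>i n. i < T \<Longrightarrow> n \<in> I \<Longrightarrow> \<bar>V i n\<bar> \<le> v n"
  shows "E ^ (\<Sum>i<T. i) * \<bar>det (mat T T (\<lambda>(i, j). \<Sum>n\<in>I. V i n * c n j))\<bar>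
     \<le> fact T * (\<Prod>j = 0..<T. \<Sum>n\<in>I. \<bar>c n j\<bar> * v n * E ^ min n T)"
proof (cases "T = 0")
  case False
  have v0: "v n \<ge> 0" if "n \<in> I" for n using V[of 0 n] that False by fastforce
  let ?D = "\<lambda>g. det (mat T T (\<lambda>(i, j). V i (g j)))"
  have bound: "E ^ (\<Sum>i<T. i) * \<bar>(\<Prod>j = 0..<T. c (g j) j) * ?D g\<bar>
      \<le> fact T * (\<Prod>j = 0..<T. \<bar>c (g j) j\<bar> * v (g j) * E ^ min (g j) T)"
    if g: "g \<in> {0..<T} \<rightarrow>\<^sub>E I" for g
  proof (cases "inj_on g {0..<T}")
    case True
    have gI: "g j \<in> I" if "j < T" for j using g that by auto
    have "(\<Sum>i<T. i) \<le> (\<Sum>n\<in>g ` {0..<T}. min n T)"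
      using sum_min_card_ge[of "g ` {0..<T}" T] by (simp add: card_image[OF True])
    also have "\<dots> = (\<Sum>j = 0..<T. min (g j) T)" by (simp add: sum.reindex[OF True])
    finally have "E ^ (\<Sum>i<T. i) \<le> (\<Prod>j = 0..<T. E ^ min (g j) T)"
      using E by (simp add: power_sum[symmetric] power_increasing)
    moreover have "\<bar>?D g\<bar> \<le> fact T * (\<Prod>j = 0..<T. v (g j))"
      by (rule abs_det_le) (use V gI in auto)
    ultimately have "E ^ (\<Sum>i<T. i) * \<bar>?D g\<bar> \<le> (\<Prod>j = 0..<T. E ^ min (g j) T) * (fact T * (\<Prod>j = 0..<T. v (g j)))"
      by (intro mult_mono) (use E in \<open>auto intro!: prod_nonneg\<close>)
    then have "(\<Prod>j = 0..<T. \<bar>c (g j) j\<bar>) * (E ^ (\<Sum>i<T. i) * \<bar>?D g\<bar>)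
      \<le> (\<Prod>j = 0..<T. \<bar>c (g j) j\<bar>) * ((\<Prod>j = 0..<T. E ^ min (g j) T) * (fact T * (\<Prod>j = 0..<T. v (g j))))"
      by (intro mult_left_mono prod_nonneg) auto
    then show ?thesis by (simp add: abs_mult abs_prod prod.distrib mult_ac)
  next
    case False
    then obtain i j where ij: "i < T" "j < T" "i \<noteq> j" "g i = g j" by (auto simp: inj_on_def)
    have "?D g = 0"
      by (rule det_identical_columns[OF _ ij(3,1,2)]) (use ij in auto)
    then show ?thesis using g E by (auto intro!: mult_nonneg_nonneg prod_nonneg v0)
  qed
  have "E ^ (\<Sum>i<T. i) * \<bar>det (mat T T (\<lambda>(i, j). \<Sum>n\<in>I. V i n * c n j))\<bar>
     \<le> E ^ (\<Sum>i<T. i) * (\<Sum>g\<in>{0..<T} \<rightarrow>\<^sub>E I. \<bar>(\<Prod>j = 0..<T. c (g j) j) * ?D g\<bar>)"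
    unfolding det_expand_columns[OF I] by (intro mult_left_mono sum_abs) (use E in auto)
  also have "\<dots> \<le> (\<Sum>g\<in>{0..<T} \<rightarrow>\<^sub>E I. fact T * (\<Prod>j = 0..<T. \<bar>c (g j) j\<bar> * v (g j) * E ^ min (g j) T))"
    unfolding sum_distrib_left by (intro sum_mono bound)
  also have "\<dots> = fact T * (\<Prod>j = 0..<T. \<Sum>n\<in>I. \<bar>c n j\<bar> * v n * E ^ min n T)"
    by (subst prod_sum_PiE) (auto simp: I sum_distrib_left)
  finally show ?thesis .
qed simp

text \<open>Border a nonzero determinant of size \<open>T\<close> by one more row, taken at a free
  point. Expansion along that row is a combination of the functions in which function
  \<open>T\<close> has the old determinant as coefficient, so independence supplies a point where it
  does not vanish.\<close>

lemma nonzero_interpolation_determinant: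
  fixes \<phi> :: "nat \<Rightarrow> 'a \<Rightarrow> real"
  assumes "\<And>c. (\<And>x. x \<in> P \<Longrightarrow> (\<Sum>j<T. c j * \<phi> j x) = 0) \<Longrightarrow> (\<And>j. j < T \<Longrightarrow> c j = 0)"
  shows "\<exists>x. (\<forall>i<T. x i \<in> P) \<and> det (mat T T (\<lambda>(i, j). \<phi> j (x i))) \<noteq> 0"
  using assms
proof (induction T)
  case 0
  then show ?case by (auto simp: det_def)
next
  case (Suc T)
  have "\<exists>x. (\<forall>i<T. x i \<in> P) \<and> det (mat T T (\<lambda>(i, j). \<phi> j (x i))) \<noteq> 0"
  proof (rule Suc.IH)
    fix c :: "nat \<Rightarrow> real" and j
    assume *: "\<And>x. x \<in> P \<Longrightarrow> (\<Sum>j<T. c j * \<phi> j x) = 0" and "j < T"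
    have "(\<lambda>j. if j < T then c j else 0) j = 0"
      by (rule Suc.prems) (use * \<open>j < T\<close> in auto)
    then show "c j = 0" using \<open>j < T\<close> by simp
  qed
  then obtain x where x: "\<forall>i<T. x i \<in> P" "det (mat T T (\<lambda>(i, j). \<phi> j (x i))) \<noteq> 0" by blast
  define A where "A y = mat (Suc T) (Suc T) (\<lambda>(i, j). \<phi> j ((x(T := y)) i))" for y
  \<comment> \<open>Cofactors of the last row do not see the point placed there, so any value, here
    \<open>undefined\<close>, may stand for it.\<close>
  define c where "c j = cofactor (A undefined) T j" for j
  have del: "mat_delete (A y) T j = mat_delete (A undefined) T j" if "j < Suc T" for y j
    by (rule eq_matI) (auto simp: mat_delete_def A_def)
  have detA: "det (A y) = (\<Sum>j<Suc T. c j * \<phi> j y)" for y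
  proof -
    have "det (A y) = (\<Sum>j<Suc T. A y $$ (T, j) * cofactor (A y) T j)"
      by (rule laplace_expansion_row) (auto simp: A_def)
    also have "\<dots> = (\<Sum>j<Suc T. c j * \<phi> j y)"
    proof (intro sum.cong refl)
      fix j assume "j \<in> {..<Suc T}"
      then have "cofactor (A y) T j = c j" and "A y $$ (T, j) = \<phi> j y"
        by (simp_all only: c_def cofactor_def del[of j y] lessThan_iff) (simp add: A_def)
      then show "A y $$ (T, j) * cofactor (A y) T j = c j * \<phi> j y" by simp
    qed
    finally show ?thesis .
  qed
  have "mat_delete (A undefined) T T = mat T T (\<lambda>(i, j). \<phi> j (x i))"
    by (rule eq_matI) (auto simp: mat_delete_def A_def)
  then have "c T \<noteq> 0" using x(2) by (simp add: c_def cofactor_def)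
  then obtain y where y: "y \<in> P" "det (A y) \<noteq> 0"
    using Suc.prems[of c T] detA by auto
  then show ?case using x(1) by (intro exI[of _ "x(T := y)"]) (auto simp: A_def less_Suc_eq)
qed

text \<open>Writing \<open>P X Y = (\<Sum>l\<in>I. p l X * Y ^ l)\<close>, the combination
  \<open>p l\<^sub>0 X * P (X + 1) (\<xi> * Y) - \<xi> ^ l\<^sub>0 * p l\<^sub>0 (X + 1) * P X Y\<close> has lost exactly the power \<open>Y ^ l\<^sub>0\<close>,
  at the cost of one value of \<open>r\<close> and of doubling the degrees.\<close>

lemma zero_estimate:
  fixes p :: "nat \<Rightarrow> real poly" and \<xi> a :: real
  assumes "finite I" "I \<noteq> {}" "\<And>l. l \<in> I \<Longrightarrow> p l \<noteq> 0 \<and> degree (p l) \<le> D"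
    and "\<xi> > 0" "\<xi> \<noteq> 1" "a > 0" "R \<le> N"
    and "\<And>r s. r < R \<Longrightarrow> s < S \<Longrightarrow>
           (\<Sum>l\<in>I. poly (p l) (real (r + s * N)) * (\<xi> ^ r * a ^ s) ^ l) = 0"
  shows "(R + 1 - card I) * S \<le> 2 ^ (card I - 1) * D"
  using assms
proof (induction "card I" arbitrary: I p D R)
  case 0
  then show ?case by simp
next
  case (Suc m)
  obtain l0 where l0: "l0 \<in> I" using Suc.prems(2) by blast
  show ?case
  proof (cases "m = 0")
    case True
    then have I: "I = {l0}" using Suc.hyps(2) l0 by (metis One_nat_def card_1_singletonE singletonD)
    \<comment> \<open>With a single exponent left, the nonzero polynomial \<open>p l0\<close>
      vanishes at the \<open>R * S\<close> points \<open>r + s * N\<close>, which are distinct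
      because \<open>r < R \<le> N\<close>.\<close>
    let ?f = "\<lambda>(r, s). real (r + s * N)"
    have "inj_on ?f ({..<R} \<times> {..<S})"
    proof (rule inj_onI)
      fix x y assume xy: "x \<in> {..<R} \<times> {..<S}" "y \<in> {..<R} \<times> {..<S}" "?f x = ?f y"
      obtain r s r' s' where [simp]: "x = (r, s)" "y = (r', s')" by (cases x, cases y)
      have lt: "r < N" "r' < N" using xy Suc.prems(7) by auto
      have eq: "r + s * N = r' + s' * N" using xy(3) unfolding \<open>x = _\<close> \<open>y = _\<close> prod.case of_nat_eq_iff .
      have "(r + s * N) div N = s" "(r' + s' * N) div N = s'" using lt by simp_all
      then have "s = s'" using eq by simp
      moreover note eq
      ultimately show "x = y" by simp
    qed
    then have "card (?f ` ({..<R} \<times> {..<S})) = R * S" by (simp add: card_image)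
    moreover have "?f ` ({..<R} \<times> {..<S}) \<subseteq> {x. poly (p l0) x = 0}"
    proof -
      have "poly (p l0) (real (r + s * N)) = 0" if "r < R" "s < S" for r s
      proof -
        have "(\<xi> ^ r * a ^ s) ^ l0 \<noteq> 0" using Suc.prems(4,6) by simp
        moreover have "poly (p l0) (real (r + s * N)) * (\<xi> ^ r * a ^ s) ^ l0 = 0"
          using Suc.prems(8)[OF that] unfolding I by simp
        ultimately show ?thesis by (metis mult_eq_0_iff)
      qed
      then show ?thesis by auto
    qed
    ultimately have "R * S \<le> card {x. poly (p l0) x = 0}"
      using Suc.prems(3)[OF l0] poly_roots_finite[of "p l0"] card_mono by metis
    also have "\<dots> \<le> D"
      using Suc.prems(3)[OF l0] card_poly_roots_bound[of "p l0"] by (meson order_trans)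
    finally have "R * S \<le> D" .
    then show ?thesis by (simp add: I)
  next
    case False
    define J where "J = I - {l0}"
    have J: "finite J" "card J = m" using Suc.prems(1) Suc.hyps(2) l0 by (simp_all add: J_def)
    with False have "J \<noteq> {}" by auto
    note J = J this
    \<comment> \<open>Shifting the polynomial variable by one matches the passage from
      \<open>r\<close> to \<open>r + 1\<close>, which also multiplies the exponential variable by
      \<open>\<xi>\<close>.\<close>
    define sh where "sh f = pcompose f [:1, 1:]" for f :: "real poly"
    have sh: "poly (sh f) (real x) = poly f (real (Suc x))" for f x
      by (simp add: sh_def poly_pcompose)
    have dsh: "degree (sh f) = degree f" "lead_coeff (sh f) = lead_coeff f" for f
      using lead_coeff_comp[of "[:1, 1:]" f] by (simp_all add: sh_def degree_pcompose)
    define q where "q l = smult (\<xi> ^ l) (p l0 * sh (p l)) - smult (\<xi> ^ l0) (sh (p l0) * p l)" for l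
    have q: "q l \<noteq> 0 \<and> degree (q l) \<le> 2 * D" if "l \<in> J" for l
    proof
      have l: "l \<in> I" "l \<noteq> l0" using that by (auto simp: J_def)
      note P = Suc.prems(3)[OF l(1)] Suc.prems(3)[OF l0]
      have "sh (p l) \<noteq> 0" "sh (p l0) \<noteq> 0" using P dsh(2) by (metis leading_coeff_0_iff)+
      then have d: "degree (p l0 * sh (p l)) = degree (p l0) + degree (p l)"
          "degree (sh (p l0) * p l) = degree (p l0) + degree (p l)"
        using P by (simp_all add: degree_mult_eq dsh)
      \<comment> \<open>The two products have the same degree, and their leading terms cannot cancel
        because \<open>\<xi> ^ l\<close> and \<open>\<xi> ^ l0\<close> differ.\<close>
      have "coeff (q l) (degree (p l0) + degree (p l))
          = \<xi> ^ l * (lead_coeff (p l0 * sh (p l))) - \<xi> ^ l0 * lead_coeff (sh (p l0) * p l)"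
        by (simp only: q_def coeff_diff coeff_smult d)
      also have "\<dots> = (\<xi> ^ l - \<xi> ^ l0) * lead_coeff (p l0) * lead_coeff (p l)"
        unfolding lead_coeff_mult dsh(2) by (simp add: algebra_simps)
      also have "\<dots> \<noteq> 0"
      proof -
        have "\<xi> ^ l \<noteq> \<xi> ^ l0"
          using l(2) Suc.prems(4,5) power_inject_exp' by metis
        then show ?thesis using P by simp
      qed
      finally show "q l \<noteq> 0" by auto
      show "degree (q l) \<le> 2 * D"
        unfolding q_def
        by (intro degree_diff_le order_trans[OF degree_smult_le]) (use P d in auto)
    qed
    have "(R - 1 + 1 - card J) * S \<le> 2 ^ (card J - 1) * (2 * D)"
    proof (rule Suc.hyps(1))
      show "m = card J" "finite J" "J \<noteq> {}" using J by simp_all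
      show "q l \<noteq> 0 \<and> degree (q l) \<le> 2 * D" if "l \<in> J" for l by (rule q[OF that])
      show "R - 1 \<le> N" using Suc.prems(7) by simp
      fix r s assume rs: "r < R - 1" "s < S"
      let ?y = "\<xi> ^ r * a ^ s" and ?x = "r + s * N"
      have z0: "(\<Sum>l\<in>I. poly (p l) (real ?x) * ?y ^ l) = 0"
        using rs by (intro Suc.prems(8)) auto
      have "(\<Sum>l\<in>I. poly (p l) (real (Suc r + s * N)) * (\<xi> ^ Suc r * a ^ s) ^ l) = 0"
        using rs by (intro Suc.prems(8)) auto
      then have z1: "(\<Sum>l\<in>I. poly (sh (p l)) (real ?x) * (\<xi> ^ l * ?y ^ l)) = 0"
        unfolding sh by (simp add: power_mult_distrib mult_ac del: of_nat_add of_nat_Suc)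
      have "(\<Sum>l\<in>I. poly (q l) (real ?x) * ?y ^ l) =
        poly (p l0) (real ?x) * (\<Sum>l\<in>I. poly (sh (p l)) (real ?x) * (\<xi> ^ l * ?y ^ l))
        - \<xi> ^ l0 * poly (sh (p l0)) (real ?x) * (\<Sum>l\<in>I. poly (p l) (real ?x) * ?y ^ l)"
        by (simp add: q_def sum_distrib_left sum_subtractf[symmetric] algebra_simps del: of_nat_add of_nat_mult)
      also have "\<dots> = 0" using z0 z1 by simp
      finally have "(\<Sum>l\<in>I. poly (q l) (real ?x) * ?y ^ l) = 0" .
      moreover have "q l0 = 0" by (simp add: q_def mult.commute)
      ultimately show "(\<Sum>l\<in>J. poly (q l) (real ?x) * ?y ^ l) = 0"
        using sum.remove[OF Suc.prems(1) l0, of "\<lambda>l. poly (q l) (real ?x) * ?y ^ l"] by (simp add: J_def)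
    qed (use Suc.prems in auto)
    \<comment> \<open>Truncated subtraction does no harm at \<open>R = 0\<close>, since
      \<open>J\<close> is nonempty.\<close>
    moreover have "R - 1 + 1 - card J \<ge> R + 1 - card I" using J Suc.hyps(2) False by linarith
    moreover have "card I - 1 = Suc (card J - 1)" using J Suc.hyps(2) False by linarith
    then have "2 ^ (card J - 1) * (2 * D) = 2 ^ (card I - 1) * D" by simp
    ultimately show ?thesis by (metis mult_le_mono1 order_trans)
  qed
qed

section \<open>Linear forms in two logarithms\<close>

definition binomial_poly :: "nat \<Rightarrow> real poly" where
  "binomial_poly k = smult (1 / fact k) (\<Prod>i = 0..<k. [:- real i, 1:])"

lemma poly_binomial_poly: "poly (binomial_poly k) (real x) = real (x choose k)"
  by (simp add: binomial_poly_def poly_prod binomial_gbinomial gbinomial_prod_rev)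

lemma degree_binomial_poly: "degree (binomial_poly k) \<le> k"
proof -
  have "degree (\<Prod>i = 0..<k. [:- real i, 1:]) \<le> (\<Sum>i = 0..<k. degree [:- real i, 1:])"
    by (rule degree_prod_sum_le[unfolded comp_def]) simp
  then show ?thesis
    unfolding binomial_poly_def by (intro order_trans[OF degree_smult_le]) simp
qed

text \<open>Numbers the pairs \<open>(k, l)\<close> by \<open>j = k * L + l\<close>, so that the
  \<open>K * L\<close> interpolated functions can be the columns of a square matrix.\<close>

lemma sum_div_mod:
  fixes f :: "nat \<Rightarrow> nat \<Rightarrow> real"
  shows "(\<Sum>j<K * L. f (j div L) (j mod L)) = (\<Sum>l<L. \<Sum>k<K. f k l)"
proof -
  have "(\<Sum>j<K * L. f (j div L) (j mod L)) = (\<Sum>(l, k)\<in>{..<L} \<times> {..<K}. f k l)"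
  proof (rule sum.reindex_bij_witness[where i = "\<lambda>(l, k). k * L + l" and j = "\<lambda>j. (j mod L, j div L)"])
    fix j assume "j \<in> {..<K * L}"
    moreover from this have "L > 0" by (cases L) auto
    ultimately show "(j mod L, j div L) \<in> {..<L} \<times> {..<K}"
      by (auto simp: less_mult_imp_div_less)
  next
    fix x assume x: "x \<in> {..<L} \<times> {..<K}"
    obtain l k where [simp]: "x = (l, k)" by (cases x)
    have "k * L + l < (k + 1) * L" using x by simp
    also have "\<dots> \<le> K * L" using x by (intro mult_le_mono1) auto
    finally show "(case x of (l, k) \<Rightarrow> k * L + l) \<in> {..<K * L}" by simp
  qed auto
  then show ?thesis by (simp add: sum.cartesian_product)
qed

text \<open>Write \<open>z ^ x = z ^ k * (1 + (z - 1)) ^ (x - k)\<close> and merge the binomials by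
  \<open>choose_mult\<close>. The coefficient of \<open>x choose n\<close> no longer depends on
  \<open>x\<close>, so this takes the place of a Taylor expansion, with factors
  \<open>(z - 1) ^ (n - k)\<close> that are tiny for \<open>z\<close> near one. The common range up
  to \<open>X\<close> is harmless because \<open>x choose n\<close> vanishes for
  \<open>n > x\<close>.\<close>

lemma binomial_times_power_expand:
  fixes z :: real
  assumes "x \<le> X"
  shows "real (x choose k) * z ^ x
    = (\<Sum>n\<le>X. real (x choose n) * (if k \<le> n then z ^ k * real (n choose k) * (z - 1) ^ (n - k) else 0))"
proof (cases "k \<le> x")
  case False
  have "(\<Sum>n\<le>X. real (x choose n) * (if k \<le> n then z ^ k * real (n choose k) * (z - 1) ^ (n - k) else 0)) = 0"
    by (rule sum.neutral) (use False in auto)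
  then show ?thesis using False by simp
next
  case True
  have "z ^ (x - k) = (\<Sum>m\<le>x - k. real ((x - k) choose m) * (z - 1) ^ m)"
    using binomial_ring[of "z - 1" 1 "x - k"] by simp
  then have "real (x choose k) * z ^ x
      = (\<Sum>m\<le>x - k. real (x choose k) * real ((x - k) choose m) * z ^ k * (z - 1) ^ m)"
    using True power_add[of z k "x - k"] by (simp add: sum_distrib_left mult_ac)
  also have "\<dots> = (\<Sum>n\<in>{k..x}. real (x choose n) * (z ^ k * real (n choose k) * (z - 1) ^ (n - k)))"
  proof (rule sum.reindex_bij_witness[where i = "\<lambda>n. n - k" and j = "\<lambda>m. m + k"])
    fix m assume m: "m \<in> {..x - k}"
    have "(x choose (m + k)) * ((m + k) choose k) = (x choose k) * ((x - k) choose m)"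
      using choose_mult[of k "m + k" x] m True by simp
    then have "real (x choose (m + k)) * real ((m + k) choose k) = real (x choose k) * real ((x - k) choose m)"
      by (metis of_nat_mult)
    then show "real (x choose (m + k)) * (z ^ k * real ((m + k) choose k) * (z - 1) ^ (m + k - k))
      = real (x choose k) * real ((x - k) choose m) * z ^ k * (z - 1) ^ m"
      by (simp add: mult_ac)
  qed (use True in auto)
  also have "\<dots> = (\<Sum>n\<le>X. if n \<in> {k..x} then real (x choose n) * (z ^ k * real (n choose k) * (z - 1) ^ (n - k)) else 0)"
    using assms by (subst sum.inter_restrict[symmetric]) (auto intro!: sum.cong)
  also have "\<dots> = (\<Sum>n\<le>X. real (x choose n) * (if k \<le> n then z ^ k * real (n choose k) * (z - 1) ^ (n - k) else 0))"
    by (intro sum.cong) auto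
  finally show ?thesis .
qed

text \<open>Isolates one term in the expansion of \<open>(1 + K / X) ^ X \<le> exp K\<close>; since
  \<open>K / X \<le> 1\<close>, the exponent \<open>k\<close> may be raised to
  \<open>K\<close>.\<close>

lemma binomial_le_exp:
  assumes "k \<le> K" "0 < K" "K \<le> X"
  shows "real (X choose k) \<le> exp K * (X / K) ^ K"
proof -
  define y where "y = real K / real X"
  have y: "0 < y" "y \<le> 1" using assms by (auto simp: y_def)
  have "real (X choose k) * y ^ k \<le> (\<Sum>n\<le>X. real (X choose n) * y ^ n)"
    using assms y by (intro member_le_sum[of k "{..X}"]) auto
  also have "\<dots> = (1 + y) ^ X" using binomial_ring[of y 1 X] by (simp add: add.commute)
  also have "\<dots> \<le> exp y ^ X" using y by (intro power_mono) auto
  also have "\<dots> = exp K" using assms by (simp add: y_def flip: exp_of_nat_mult)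
  finally have *: "real (X choose k) * y ^ k \<le> exp K" .
  have "real (X choose k) * y ^ K \<le> real (X choose k) * y ^ k"
    using y assms by (intro mult_left_mono power_decreasing) auto
  also note *
  finally have "real (X choose k) \<le> exp K / y ^ K" using y by (simp add: field_simps)
  also have "\<dots> = exp K * (X / K) ^ K" using assms by (simp add: y_def power_divide)
  finally show ?thesis .
qed

lemma abs_exp_minus_one_le:
  fixes y :: real
  assumes "\<bar>y\<bar> \<le> 1"
  shows "\<bar>exp y - 1\<bar> \<le> 2 * \<bar>y\<bar>"
proof (cases "y \<ge> 0")
  case True
  have "exp y \<le> 1 + y + y\<^sup>2" using True assms by (intro exp_bound) auto
  moreover have "y\<^sup>2 \<le> y" using True assms by (simp add: power2_eq_square mult_left_le)
  moreover have "exp y \<ge> 1" using True by simp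
  ultimately show ?thesis using True by linarith
next
  case False
  have "exp y \<ge> 1 + y" by (rule exp_ge_add_one_self)
  moreover have "exp y < 1" using False by simp
  ultimately show ?thesis using False by linarith
qed

text \<open>Terms with the same exponent \<open>l = j mod L\<close> are collected into polynomials
  \<open>p l\<close> of degree below \<open>K\<close>. A nontrivial relation keeps some
  \<open>p l\<close> nonzero and contradicts \<open>zero_estimate\<close>, even in the worst case of
  \<open>L\<close> surviving exponents.\<close>

lemma exp_poly_independent:
  fixes \<xi> a :: real
  assumes "\<xi> > 0" "\<xi> \<noteq> 1" "a > 0" "R \<le> N" "2 ^ (L - 1) * (K - 1) < (R + 1 - L) * S"
    and z: "\<And>r s. r < R \<Longrightarrow> s < S \<Longrightarrow>
       (\<Sum>j<K * L. c j * (real ((r + s * N) choose (j div L)) * (\<xi> ^ r * a ^ s) ^ (j mod L))) = 0"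
    and j: "j < K * L"
  shows "c j = 0"
proof (rule ccontr)
  assume cj: "c j \<noteq> 0"
  have L: "L > 0" using j by (cases L) auto
  define p where "p l = (\<Sum>k<K. smult (c (k * L + l)) (binomial_poly k))" for l
  define I where "I = {l. l < L \<and> p l \<noteq> 0}"
  have pe: "poly (p l) (real x) = (\<Sum>k<K. c (k * L + l) * real (x choose k))" for l x
    by (simp add: p_def poly_sum poly_binomial_poly)
  have "p (j mod L) \<noteq> 0"
  proof -
    \<comment> \<open>Evaluation at the least \<open>k\<close> with a nonzero coefficient isolates
      that coefficient: smaller indices have coefficient zero, and \<open>k choose i\<close> is zero
      for larger \<open>i\<close>.\<close>
    let ?P = "\<lambda>k. c (k * L + j mod L) \<noteq> 0"
    define k where "k = (LEAST k. ?P k)"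
    have "?P (j div L)" using cj by simp
    then have k: "?P k" "k \<le> j div L" unfolding k_def by (rule LeastI, rule Least_le)
    have "k < K" using k(2) less_mult_imp_div_less[OF j] by simp
    have "poly (p (j mod L)) (real k) = (\<Sum>i<K. if i = k then c (k * L + j mod L) else 0)"
      unfolding pe
    proof (intro sum.cong refl)
      fix i
      have "c (i * L + j mod L) = 0" if "i < k" using not_less_Least[of i ?P] that by (simp add: k_def)
      then show "c (i * L + j mod L) * real (k choose i) = (if i = k then c (k * L + j mod L) else 0)"
        by (cases i k rule: linorder_cases) auto
    qed
    also have "\<dots> \<noteq> 0" using k \<open>k < K\<close> by simp
    finally show ?thesis by auto
  qed
  then have I: "finite I" "I \<noteq> {}" "card I \<le> L"
    using L card_mono[of "{..<L}" I] by (auto simp: I_def intro!: exI[of _ "j mod L"])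
  have "(R + 1 - card I) * S \<le> 2 ^ (card I - 1) * (K - 1)"
  proof (rule zero_estimate[of I p "K - 1" \<xi> a R N S])
    show "p l \<noteq> 0 \<and> degree (p l) \<le> K - 1" if "l \<in> I" for l
    proof
      show "degree (p l) \<le> K - 1" unfolding p_def
        by (intro degree_sum_le order_trans[OF degree_smult_le] order_trans[OF degree_binomial_poly]) auto
    qed (use that in \<open>simp add: I_def\<close>)
    fix r s assume rs: "r < R" "s < S"
    have "0 = (\<Sum>l<L. \<Sum>k<K. c (k * L + l) * (real ((r + s * N) choose k) * (\<xi> ^ r * a ^ s) ^ l))"
      using z[OF rs] sum_div_mod[of "\<lambda>k l. c (k * L + l) * (real ((r + s * N) choose k) * (\<xi> ^ r * a ^ s) ^ l)" L K]
      by simp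
    also have "\<dots> = (\<Sum>l<L. poly (p l) (real (r + s * N)) * (\<xi> ^ r * a ^ s) ^ l)"
      unfolding pe by (simp add: sum_distrib_left mult_ac)
    also have "\<dots> = (\<Sum>l\<in>I. poly (p l) (real (r + s * N)) * (\<xi> ^ r * a ^ s) ^ l)"
      by (rule sum.mono_neutral_right) (auto simp: I_def)
    finally show "(\<Sum>l\<in>I. poly (p l) (real (r + s * N)) * (\<xi> ^ r * a ^ s) ^ l) = 0" by simp
  qed (use assms I in auto)
  also have "\<dots> \<le> 2 ^ (L - 1) * (K - 1)"
    using I by (intro mult_le_mono1 power_increasing) auto
  also have "\<dots> < (R + 1 - L) * S" by fact
  also have "\<dots> \<le> (R + 1 - card I) * S" using I by (intro mult_le_mono1) auto
  finally show False by simp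
qed

lemma clear_denominator:
  fixes p q :: nat
  assumes "q > 0" and "l \<le> m"
  shows "real q ^ (m * r) * ((real p / real q) ^ r) ^ l = real q ^ ((m - l) * r) * real p ^ (l * r)"
proof -
  obtain d where d: "m = l + d" using assms(2) le_Suc_ex by blast
  have "real q ^ (m * r) = real q ^ (d * r) * real q ^ (l * r)"
    unfolding d add_mult_distrib power_add by (rule mult.commute)
  moreover have "((real p / real q) ^ r) ^ l = real p ^ (l * r) / real q ^ (l * r)"
    by (simp add: power_divide mult.commute[of l] power_mult)
  ultimately show ?thesis using assms(1) by (simp add: d)
qed

text \<open>Compares two bounds for a determinant of size \<open>T = K * L\<close>. As a nonzero
  integer it has absolute value at least one, while \<open>det_weighted_bound\<close> caps it times
  \<open>E ^ (\<Sum>i<T. i)\<close> by \<open>(T * B) ^ T\<close>; take logarithms and divide by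
  \<open>T\<close>. On the right stand, in order: the factorial with a factor two for main term and
  error, the weight lost to the degree in \<open>x\<close>, the binomials, the growth of powers of
  \<open>\<xi>\<close>, and the denominators.\<close>

lemma two_log_inequality:
  fixes p q p' q' N R S K L :: nat and E \<mu> h1 h2 \<xi> a \<Lambda> :: real
  defines "\<xi> \<equiv> real p / real q" and "a \<equiv> real p' / real q'"
  defines "\<Lambda> \<equiv> ln a - N * ln \<xi>"
  assumes pos: "p > 0" "q > 0" "p' > 0" "q' > 0" and "p \<noteq> q"
    and "R \<le> N" "S > 0" "K > 0" "L > 0" "E \<ge> 1" "K \<le> S * N"
    and zero: "2 ^ (L - 1) * (K - 1) < (R + 1 - L) * S"
    and lam: "\<bar>ln \<xi>\<bar> \<le> \<mu>" "L * \<mu> \<le> 1"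
    and h: "ln q \<le> h1" "ln q' \<le> h2"
    and small: "E ^ (K * L) * (2 * L * S * \<bar>\<Lambda>\<bar>) \<le> 1"
  shows "(real (K * L) - 1) / 2 * ln E \<le> ln (2 * real (K * L)) + K * ln E
     + K * (1 + ln (real (S * N) / K)) + 3 * E * L * (S * N) * \<mu> + L * (R * h1 + S * h2)"
proof -
  define T where "T = K * L"
  define X where "X = S * N"
  define ki where "ki j = j div L" for j :: nat
  define li where "li j = j mod L" for j :: nat
  have T0: "T > 0" using \<open>K > 0\<close> \<open>L > 0\<close> by (simp add: T_def)
  have ki: "ki j < K" and li: "li j < L" if "j < T" for j
    using that \<open>L > 0\<close> by (auto simp: ki_def li_def T_def less_mult_imp_div_less)
  have \<xi>: "\<xi> > 0" "\<xi> \<noteq> 1" and a: "a > 0" using pos \<open>p \<noteq> q\<close> by (auto simp: \<xi>_def a_def)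
  \<comment> \<open>These factors clear all denominators, because every exponent \<open>li j\<close>
    is at most \<open>L - 1\<close>. They are positive and depend only on the row, so the
    independence of the functions is not affected.\<close>
  define \<rho> where "\<rho> r s = real q ^ ((L - 1) * r) * real q' ^ ((L - 1) * s)" for r s
  have \<rho>: "\<rho> r s > 0" for r s using pos by (simp add: \<rho>_def)
  define \<phi> where "\<phi> j = (\<lambda>(r, s). \<rho> r s * (real ((r + s * N) choose ki j) * (\<xi> ^ r * a ^ s) ^ li j))" for j
  have "\<exists>x. (\<forall>i<T. x i \<in> {..<R} \<times> {..<S}) \<and> det (mat T T (\<lambda>(i, j). \<phi> j (x i))) \<noteq> 0"
  proof (rule nonzero_interpolation_determinant)
    fix c j assume c: "\<And>x. x \<in> {..<R} \<times> {..<S} \<Longrightarrow> (\<Sum>j<T. c j * \<phi> j x) = 0" and j: "j < T"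
    show "c j = 0"
    proof (rule exp_poly_independent[OF \<xi> a \<open>R \<le> N\<close> zero])
      fix r s assume "r < R" "s < S"
      then have "(\<Sum>j<T. c j * \<phi> j (r, s)) = 0" by (intro c) auto
      also have "(\<Sum>j<T. c j * \<phi> j (r, s)) = \<rho> r s *
        (\<Sum>j<T. c j * (real ((r + s * N) choose ki j) * (\<xi> ^ r * a ^ s) ^ li j))"
        by (simp add: \<phi>_def sum_distrib_left mult_ac)
      finally show "(\<Sum>j<K * L. c j * (real ((r + s * N) choose (j div L)) * (\<xi> ^ r * a ^ s) ^ (j mod L))) = 0"
        using \<rho>[of r s] by (simp add: T_def ki_def li_def)
    qed (use j in \<open>simp add: T_def\<close>)
  qed
  then obtain pt where pt: "\<And>i. i < T \<Longrightarrow> pt i \<in> {..<R} \<times> {..<S}"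
    and det0: "det (mat T T (\<lambda>(i, j). \<phi> j (pt i))) \<noteq> 0" by blast
  define rr where "rr i = fst (pt i)" for i
  define ss where "ss i = snd (pt i)" for i
  define x where "x i = rr i + ss i * N" for i
  have rs: "rr i < R" "ss i < S" if "i < T" for i using pt[OF that] by (auto simp: rr_def ss_def)
  have xX: "x i \<le> X" if "i < T" for i
  proof -
    have "x i \<le> N + ss i * N" using rs[OF that] \<open>R \<le> N\<close> by (simp add: x_def)
    also have "\<dots> = (ss i + 1) * N" by simp
    also have "\<dots> \<le> S * N" using rs[OF that] by (intro mult_le_mono1) auto
    finally show ?thesis by (simp add: X_def)
  qed
  define \<Delta> where "\<Delta> = det (mat T T (\<lambda>(i, j). \<phi> j (pt i)))"
  have "\<phi> j (pt i) \<in> \<int>" if "j < T" for i j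
  proof -
    let ?l = "li j" let ?r = "rr i" let ?s = "ss i"
    have l: "?l \<le> L - 1" using li[OF that] by simp
    have "\<rho> ?r ?s * (\<xi> ^ ?r * a ^ ?s) ^ ?l
        = (real q ^ ((L - 1) * ?r) * (\<xi> ^ ?r) ^ ?l) * (real q' ^ ((L - 1) * ?s) * (a ^ ?s) ^ ?l)"
      unfolding \<rho>_def power_mult_distrib by (simp only: mult_ac)
    also have "\<dots> = real q ^ ((L - 1 - ?l) * ?r) * real p ^ (?l * ?r)
        * (real q' ^ ((L - 1 - ?l) * ?s) * real p' ^ (?l * ?s))"
      unfolding \<xi>_def a_def clear_denominator[OF \<open>q > 0\<close> l] clear_denominator[OF \<open>q' > 0\<close> l] ..
    finally have "\<rho> ?r ?s * (\<xi> ^ ?r * a ^ ?s) ^ ?l =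
        real q ^ ((L - 1 - ?l) * ?r) * real p ^ (?l * ?r)
        * (real q' ^ ((L - 1 - ?l) * ?s) * real p' ^ (?l * ?s))" .
    then have "\<phi> j (pt i) = of_nat (((?r + ?s * N) choose ki j) *
      (q ^ ((L - 1 - ?l) * ?r) * p ^ (?l * ?r) * (q' ^ ((L - 1 - ?l) * ?s) * p' ^ (?l * ?s))))"
      unfolding \<phi>_def rr_def[symmetric] ss_def[symmetric] split_beta
      by (simp only: of_nat_mult of_nat_power mult.left_commute[of "\<rho> _ _"])
    then show ?thesis by (metis Ints_of_nat)
  qed
  then have "\<Delta> \<in> \<int>"
    unfolding \<Delta>_def by (subst det_def'[of _ T])
      (auto intro!: Ints_sum Ints_mult Ints_prod simp: permutes_in_image[of _ "{0..<T}", simplified])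
  then have \<Delta>1: "\<bar>\<Delta>\<bar> \<ge> 1" using det0 by (simp add: Ints_nonzero_abs_ge1 \<Delta>_def)

  \<comment> \<open>The indices \<open>n \<le> X\<close> stand for the functions \<open>x choose n\<close>; the index \<open>X + 1 + j\<close> carries the
    error made in column \<open>j\<close> by replacing \<open>a\<close> with \<open>\<xi> ^ N\<close>.\<close>
  define z where "z l = \<xi> ^ l" for l
  define V where "V i n = \<rho> (rr i) (ss i) * (if n \<le> X then real (x i choose n) else
     let j = n - X - 1 in real (x i choose ki j) * z (li j) ^ x i * (exp (li j * ss i * \<Lambda>) - 1))" for i n
  define c where "c n j = (if n \<le> X then
      (if ki j \<le> n then z (li j) ^ ki j * real (n choose ki j) * (z (li j) - 1) ^ (n - ki j) else 0)
     else if n = X + 1 + j then 1 else 0)" for n j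
  define W where "W = real q ^ (L * R) * real q' ^ (L * S)"
  define v where "v n = W * (if n \<le> X then real (X choose n) else
     real (X choose ki (n - X - 1)) * exp (L * X * \<mu>) * (2 * L * S * \<bar>\<Lambda>\<bar>))" for n
  let ?I = "{..X + T}"
  have lam0: "\<mu> \<ge> 0" using lam by linarith
  have W0: "W > 0" using pos by (simp add: W_def)
  have \<rho>W: "\<rho> (rr i) (ss i) \<le> W" if "i < T" for i
    unfolding \<rho>_def W_def using rs[OF that] pos
    by (intro mult_mono power_increasing mult_le_mono) auto
  have zx: "z l ^ m \<le> exp (L * X * \<mu>)" if "l < L" "m \<le> X" for l m
  proof -
    have "z l ^ m = exp (real (l * m) * ln \<xi>)"
      using \<xi> unfolding exp_of_nat_mult by (simp add: z_def power_mult)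
    moreover have "real (l * m) * ln \<xi> \<le> real (L * X) * \<mu>"
    proof -
      have "real (l * m) * ln \<xi> \<le> real (l * m) * \<mu>" using lam by (intro mult_left_mono) auto
      moreover have "l * m \<le> L * X" using that by (intro mult_le_mono) auto
      then have "real (l * m) * \<mu> \<le> real (L * X) * \<mu>"
        by (intro mult_right_mono lam0) (simp only: of_nat_le_iff)
      ultimately show ?thesis by linarith
    qed
    ultimately show ?thesis by simp
  qed
  have L1: "2 * L * S * \<bar>\<Lambda>\<bar> \<le> 1"
  proof -
    have "1 * (2 * L * S * \<bar>\<Lambda>\<bar>) \<le> E ^ (K * L) * (2 * L * S * \<bar>\<Lambda>\<bar>)"
      using \<open>E \<ge> 1\<close> by (intro mult_right_mono) auto
    then show ?thesis using small by linarith
  qed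
  have pert: "\<bar>exp (l * s * \<Lambda>) - 1\<bar> \<le> 2 * L * S * \<bar>\<Lambda>\<bar>" if "l < L" "s < S" for l s :: nat
  proof -
    have "l * s \<le> L * S" using that by (intro mult_le_mono) auto
    then have "real (l * s) * \<bar>\<Lambda>\<bar> \<le> real (L * S) * \<bar>\<Lambda>\<bar>"
      by (intro mult_right_mono) (simp_all only: of_nat_le_iff abs_ge_zero)
    then have *: "\<bar>l * s * \<Lambda>\<bar> \<le> L * S * \<bar>\<Lambda>\<bar>" by (simp add: abs_mult)
    then have "\<bar>exp (l * s * \<Lambda>) - 1\<bar> \<le> 2 * \<bar>l * s * \<Lambda>\<bar>"
      using L1 by (intro abs_exp_minus_one_le) linarith
    then show ?thesis using * by linarith
  qed
  have Vv: "\<bar>V i n\<bar> \<le> v n" if i: "i < T" and n: "n \<in> ?I" for i n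
  proof (cases "n \<le> X")
    case True
    have "\<rho> (rr i) (ss i) * real (x i choose n) \<le> W * real (X choose n)"
      using \<rho>W[OF i] \<rho> W0 xX[OF i] by (intro mult_mono) (auto intro!: binomial_right_mono simp: less_imp_le)
    then show ?thesis using True \<rho>[of "rr i" "ss i"] by (simp add: V_def v_def abs_mult)
  next
    case False
    define j where "j = n - X - 1"
    have j: "j < T" using n False T0 by (auto simp: j_def)
    have "\<bar>V i n\<bar> = \<rho> (rr i) (ss i) * (real (x i choose ki j) * z (li j) ^ x i * \<bar>exp (li j * ss i * \<Lambda>) - 1\<bar>)"
      using False \<rho>[of "rr i" "ss i"] \<xi> by (simp add: V_def j_def Let_def abs_mult z_def)
    also have "\<dots> \<le> W * (real (X choose ki j) * exp (L * X * \<mu>) * (2 * L * S * \<bar>\<Lambda>\<bar>))"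
      using \<rho>W[OF i] \<rho> W0 xX[OF i] zx[OF li[OF j] xX[OF i]] pert[OF li[OF j] rs(2)[OF i]] \<xi>
      by (intro mult_mono) (auto intro!: binomial_right_mono mult_nonneg_nonneg simp: less_imp_le z_def)
    also have "\<dots> = v n" using False by (simp add: v_def j_def)
    finally show ?thesis .
  qed
  have expand: "\<phi> j (pt i) = (\<Sum>n\<in>?I. V i n * c n j)" if i: "i < T" and j: "j < T" for i j
  proof -
    \<comment> \<open>Since \<open>a = exp \<Lambda> * \<xi> ^ N\<close>, an entry is a function of
      the single variable \<open>x = r + s * N\<close> times \<open>exp (l * s * \<Lambda>)\<close>.
      Writing the last factor as one plus a remainder separates the main term from the
      error.\<close>
    have a_eq: "a = exp \<Lambda> * \<xi> ^ N"
    proof -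
      have "exp \<Lambda> = a / exp (N * ln \<xi>)" using a by (simp add: \<Lambda>_def exp_diff)
      then show ?thesis using \<xi> by (simp add: exp_of_nat_mult)
    qed
    have "a ^ ss i = exp (ss i * \<Lambda>) * \<xi> ^ (ss i * N)"
      unfolding a_eq power_mult_distrib exp_of_nat_mult by (simp only: power_mult[symmetric] mult.commute[of N])
    then have "\<xi> ^ rr i * a ^ ss i = \<xi> ^ x i * exp (ss i * \<Lambda>)"
      by (simp add: x_def power_add)
    then have "(\<xi> ^ rr i * a ^ ss i) ^ li j = (\<xi> ^ x i) ^ li j * exp (ss i * \<Lambda>) ^ li j"
      by (simp only: power_mult_distrib)
    also have "(\<xi> ^ x i) ^ li j = z (li j) ^ x i"
      by (simp only: z_def power_mult[symmetric] mult.commute[of "x i"])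
    also have "exp (ss i * \<Lambda>) ^ li j = exp (li j * ss i * \<Lambda>)"
      by (simp only: exp_of_nat_mult[symmetric] of_nat_mult mult.assoc)
    finally have "(\<xi> ^ rr i * a ^ ss i) ^ li j = z (li j) ^ x i * exp (li j * ss i * \<Lambda>)" .
    moreover have "\<phi> j (pt i) = \<rho> (rr i) (ss i) * (real (x i choose ki j) * (\<xi> ^ rr i * a ^ ss i) ^ li j)"
      by (simp add: \<phi>_def split_beta rr_def ss_def x_def)
    ultimately have e1: "\<phi> j (pt i) = \<rho> (rr i) (ss i) * (real (x i choose ki j) * z (li j) ^ x i)
       + \<rho> (rr i) (ss i) * (real (x i choose ki j) * z (li j) ^ x i * (exp (li j * ss i * \<Lambda>) - 1))"
      by (simp only:) (simp add: algebra_simps)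
    have "(\<Sum>n\<in>?I. V i n * c n j) = (\<Sum>n\<le>X. V i n * c n j) + (\<Sum>n\<in>{X + 1..X + T}. V i n * c n j)"
      by (subst sum.union_disjoint[symmetric]) (auto intro!: sum.cong)
    also have "(\<Sum>n\<le>X. V i n * c n j) = \<rho> (rr i) (ss i) * (real (x i choose ki j) * z (li j) ^ x i)"
      unfolding binomial_times_power_expand[OF xX[OF i]] sum_distrib_left
      by (intro sum.cong) (auto simp: V_def c_def)
    also have "(\<Sum>n\<in>{X + 1..X + T}. V i n * c n j)
      = (\<Sum>n\<in>{X + 1..X + T}. if n = X + 1 + j then V i (X + 1 + j) else 0)"
      by (intro sum.cong) (auto simp: c_def)
    also have "\<dots> = V i (X + 1 + j)" using j by simp
    also have "\<dots> = \<rho> (rr i) (ss i) * (real (x i choose ki j) * z (li j) ^ x i * (exp (li j * ss i * \<Lambda>) - 1))"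
      by (simp add: V_def)
    finally show ?thesis using e1 by simp
  qed
  define B where "B = W * (exp K * (real X / K) ^ K) * (2 * E ^ K * exp (3 * E * L * X * \<mu>))"
  have X0: "X > 0" "K \<le> X" using \<open>K \<le> S * N\<close> \<open>K > 0\<close> unfolding X_def by linarith+
  have B0: "B > 0" using W0 X0 \<open>K > 0\<close> \<open>E \<ge> 1\<close> by (simp add: B_def)
  have col: "(\<Sum>n\<in>?I. \<bar>c n j\<bar> * v n * E ^ min n T) \<le> B" if j: "j < T" for j
  proof -
    let ?k = "ki j" let ?z = "z (li j)"
    define F where "F = E ^ K * exp (3 * E * L * X * \<mu>)"
    have zp: "?z > 0" using \<xi> by (simp add: z_def)
    have z1: "\<bar>?z - 1\<bar> \<le> 2 * (L * \<mu>)"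
    proof -
      have e: "?z = exp (li j * ln \<xi>)" using \<xi> by (simp add: z_def exp_of_nat_mult)
      have "\<bar>li j * ln \<xi>\<bar> \<le> L * \<mu>"
        unfolding abs_mult using li[OF j] lam by (intro mult_mono) auto
      moreover from this have "\<bar>exp (li j * ln \<xi>) - 1\<bar> \<le> 2 * \<bar>li j * ln \<xi>\<bar>"
        using lam by (intro abs_exp_minus_one_le) linarith
      ultimately show ?thesis unfolding e by linarith
    qed
    define y where "y = E * \<bar>?z - 1\<bar>"
    have y0: "y \<ge> 0" using \<open>E \<ge> 1\<close> by (simp add: y_def)
    have yX: "(1 + y) ^ X \<le> exp (2 * E * L * X * \<mu>)"
    proof -
      have "(1 + y) ^ X \<le> exp y ^ X" using y0 by (intro power_mono) auto
      also have "\<dots> = exp (X * y)" by (simp add: exp_of_nat_mult)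
      also have "\<dots> \<le> exp (X * (E * (2 * (L * \<mu>))))"
        unfolding y_def exp_le_cancel_iff using z1 \<open>E \<ge> 1\<close> by (intro mult_left_mono) auto
      finally show ?thesis by (simp add: mult_ac)
    qed
    have zk: "?z ^ ?k \<le> exp (E * L * X * \<mu>)"
    proof -
      have "?z ^ ?k \<le> exp (L * X * \<mu>)" using ki[OF j] X0 by (intro zx li[OF j]) auto
      also have "\<dots> \<le> exp (E * (L * X * \<mu>))" unfolding exp_le_cancel_iff using \<open>E \<ge> 1\<close> lam0 mult_right_mono[of 1 E "L * X * \<mu>"] by simp
      finally show ?thesis by (simp add: mult_ac)
    qed
    have kK: "E ^ ?k \<le> E ^ K" using ki[OF j] \<open>E \<ge> 1\<close> by (intro power_increasing) auto
    \<comment> \<open>With \<open>E ^ (n - ?k)\<close> absorbed into the power of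
      \<open>?z - 1\<close> and a factor \<open>(1 + y) ^ ?k \<ge> 1\<close> inserted, the weighted
      sum becomes the binomial expansion for \<open>1 + y\<close> at the point \<open>X\<close>,
      which is then read backwards.\<close>
    have "(\<Sum>n\<le>X. \<bar>c n j\<bar> * v n * E ^ min n T)
       \<le> (\<Sum>n\<le>X. W * ?z ^ ?k * E ^ ?k * (real (X choose n) *
           (if ?k \<le> n then (1 + y) ^ ?k * real (n choose ?k) * (1 + y - 1) ^ (n - ?k) else 0)))"
    proof (intro sum_mono)
      fix n assume n: "n \<in> {..X}"
      show "\<bar>c n j\<bar> * v n * E ^ min n T \<le> W * ?z ^ ?k * E ^ ?k * (real (X choose n) *
           (if ?k \<le> n then (1 + y) ^ ?k * real (n choose ?k) * (1 + y - 1) ^ (n - ?k) else 0))"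
      proof (cases "?k \<le> n")
        case True
        have "E ^ min n T \<le> E ^ n" using \<open>E \<ge> 1\<close> by (intro power_increasing) auto
        also have "\<dots> = E ^ ?k * E ^ (n - ?k)" using True by (simp flip: power_add)
        finally have "\<bar>c n j\<bar> * v n * E ^ min n T \<le> \<bar>c n j\<bar> * v n * (E ^ ?k * E ^ (n - ?k))"
          using W0 n by (intro mult_left_mono) (auto simp: v_def)
        also have "\<dots> = W * ?z ^ ?k * E ^ ?k * (real (X choose n) * (1 * real (n choose ?k) * y ^ (n - ?k)))"
          using n True zp by (simp add: c_def v_def abs_mult power_abs y_def power_mult_distrib mult_ac)
        also have "\<dots> \<le> W * ?z ^ ?k * E ^ ?k * (real (X choose n) * ((1 + y) ^ ?k * real (n choose ?k) * y ^ (n - ?k)))"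
          using W0 zp \<open>E \<ge> 1\<close> y0 by (intro mult_left_mono mult_right_mono one_le_power) auto
        finally show ?thesis using True by simp
      qed (use n in \<open>simp add: c_def\<close>)
    qed
    also have "\<dots> = W * ?z ^ ?k * E ^ ?k * (real (X choose ?k) * (1 + y) ^ X)"
      unfolding binomial_times_power_expand[OF order_refl] by (simp only: sum_distrib_left)
    also have "\<dots> \<le> W * exp (E * L * X * \<mu>) * E ^ K * (real (X choose ?k) * exp (2 * E * L * X * \<mu>))"
      using W0 zp zk kK yX \<open>E \<ge> 1\<close> y0 by (intro mult_mono) (auto intro!: mult_nonneg_nonneg)
    also have "\<dots> = W * real (X choose ?k) * F"
    proof -
      have "3 * E * L * X * \<mu> = E * L * X * \<mu> + 2 * E * L * X * \<mu>" by simp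
      then have "exp (3 * E * L * X * \<mu>) = exp (E * L * X * \<mu>) * exp (2 * E * L * X * \<mu>)"
        by (simp only: exp_add)
      then show ?thesis unfolding F_def by (simp only: mult_ac)
    qed
    finally have s1: "(\<Sum>n\<le>X. \<bar>c n j\<bar> * v n * E ^ min n T) \<le> W * real (X choose ?k) * F" .
    have "(\<Sum>n\<in>{X + 1..X + T}. \<bar>c n j\<bar> * v n * E ^ min n T)
      = (\<Sum>n\<in>{X + 1..X + T}. if n = X + 1 + j then v (X + 1 + j) * E ^ min (X + 1 + j) T else 0)"
      by (intro sum.cong) (auto simp: c_def)
    also have "\<dots> = v (X + 1 + j) * E ^ min (X + 1 + j) T" using j by simp
    also have "\<dots> = W * real (X choose ?k) * exp (L * X * \<mu>) * (E ^ min (X + 1 + j) T * (2 * L * S * \<bar>\<Lambda>\<bar>))"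
      by (simp add: v_def)
    \<comment> \<open>Here the cut of the weight at \<open>T\<close> matters: hypothesis
      \<open>small\<close> pays for exactly \<open>E ^ T\<close>.\<close>
    also have "\<dots> \<le> W * real (X choose ?k) * exp (L * X * \<mu>) * (E ^ T * (2 * L * S * \<bar>\<Lambda>\<bar>))"
      using W0 \<open>E \<ge> 1\<close> by (intro mult_left_mono mult_right_mono power_increasing) auto
    also have "\<dots> \<le> W * real (X choose ?k) * exp (L * X * \<mu>) * 1"
      using W0 small by (intro mult_left_mono) (auto simp: T_def)
    also have "\<dots> \<le> W * real (X choose ?k) * F"
    proof -
      have "L * X * \<mu> \<le> 3 * E * (L * X * \<mu>)"
        using \<open>E \<ge> 1\<close> lam0 mult_right_mono[of 1 "3 * E" "L * X * \<mu>"] by simp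
      then have "exp (L * X * \<mu>) \<le> exp (3 * E * L * X * \<mu>)" by (simp add: mult_ac)
      also have "\<dots> \<le> F" unfolding F_def using \<open>E \<ge> 1\<close> by (simp add: one_le_power)
      finally show ?thesis using W0 by (simp add: mult_left_mono)
    qed
    finally have s2: "(\<Sum>n\<in>{X + 1..X + T}. \<bar>c n j\<bar> * v n * E ^ min n T) \<le> W * real (X choose ?k) * F" .
    have "(\<Sum>n\<in>?I. \<bar>c n j\<bar> * v n * E ^ min n T) = (\<Sum>n\<le>X. \<bar>c n j\<bar> * v n * E ^ min n T)
      + (\<Sum>n\<in>{X + 1..X + T}. \<bar>c n j\<bar> * v n * E ^ min n T)"
      by (subst sum.union_disjoint[symmetric]) (auto intro!: sum.cong)
    also have "\<dots> \<le> W * real (X choose ?k) * (2 * F)" using s1 s2 by simp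
    also have "\<dots> \<le> W * (exp K * (real X / K) ^ K) * (2 * F)"
      using binomial_le_exp[of ?k K X] ki[OF j] X0 \<open>K > 0\<close> W0 \<open>E \<ge> 1\<close>
      by (intro mult_right_mono mult_left_mono) (auto simp: F_def)
    also have "\<dots> = B" by (simp add: B_def F_def)
    finally show ?thesis .
  qed
  have "E ^ (\<Sum>i<T. i) * 1 \<le> E ^ (\<Sum>i<T. i) * \<bar>\<Delta>\<bar>"
    using \<Delta>1 \<open>E \<ge> 1\<close> by (intro mult_left_mono) auto
  also have "\<Delta> = det (mat T T (\<lambda>(i, j). \<Sum>n\<in>?I. V i n * c n j))"
    unfolding \<Delta>_def by (intro arg_cong[where f = det] eq_matI) (auto simp: expand)
  also have "E ^ (\<Sum>i<T. i) * \<bar>det (mat T T (\<lambda>(i, j). \<Sum>n\<in>?I. V i n * c n j))\<bar>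
     \<le> fact T * (\<Prod>j = 0..<T. \<Sum>n\<in>?I. \<bar>c n j\<bar> * v n * E ^ min n T)"
    by (rule det_weighted_bound) (use \<open>E \<ge> 1\<close> Vv in auto)
  also have "\<dots> \<le> real T ^ T * (\<Prod>j = 0..<T. B)"
  proof (intro mult_mono prod_mono)
    show "fact T \<le> real T ^ T" using fact_le_power[of T, where 'a = real] by simp
    show "0 \<le> (\<Sum>n\<in>?I. \<bar>c n j\<bar> * v n * E ^ min n T) \<and> (\<Sum>n\<in>?I. \<bar>c n j\<bar> * v n * E ^ min n T) \<le> B"
      if "j \<in> {0..<T}" for j
      using col[of j] that W0 \<open>E \<ge> 1\<close> by (auto intro!: sum_nonneg mult_nonneg_nonneg simp: v_def)
  qed (use W0 \<open>E \<ge> 1\<close> in \<open>auto intro!: sum_nonneg mult_nonneg_nonneg prod_nonneg simp: v_def\<close>)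
  also have "\<dots> = (real T * B) ^ T" by (simp add: power_mult_distrib)
  finally have "E ^ (\<Sum>i<T. i) \<le> (real T * B) ^ T" by simp
  then have "ln (E ^ (\<Sum>i<T. i)) \<le> ln ((real T * B) ^ T)"
    using \<open>E \<ge> 1\<close> B0 T0 by (subst ln_le_cancel_iff) auto
  then have "real (\<Sum>i<T. i) * ln E \<le> T * ln (T * B)"
    using \<open>E \<ge> 1\<close> B0 T0 by (simp add: ln_realpow)
  moreover have "real (\<Sum>i<T. i) = T * ((real T - 1) / 2)"
    by (induction T) (auto simp: field_simps)
  ultimately have "T * ((real T - 1) / 2 * ln E) \<le> T * ln (T * B)" by (simp only: mult.assoc)
  then have "(real T - 1) / 2 * ln E \<le> ln (T * B)" using T0 by simp
  also have "ln (T * B) = ln (2 * T) + K * ln E + K * (1 + ln (real X / K)) + 3 * E * L * X * \<mu>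
      + L * (R * ln q + S * ln q')"
    unfolding B_def W_def using T0 pos X0 \<open>K > 0\<close> \<open>E \<ge> 1\<close>
    by (simp add: ln_mult ln_realpow algebra_simps)
  finally have "(real T - 1) / 2 * ln E \<le> ln (2 * T) + K * ln E + K * (1 + ln (real X / K))
      + 3 * E * L * X * \<mu> + L * (R * ln q + S * ln q')" .
  moreover have "L * (R * ln q + S * ln q') \<le> L * (R * h1 + S * h2)"
    using h by (intro mult_left_mono add_mono) auto
  ultimately show ?thesis by (simp add: T_def X_def)
qed

section \<open>Choice of parameters in the two-logarithm inequality\<close>

lemma ln2_ge_half: "1 / 2 \<le> ln (2::real)"
  using ln_le_minus_one[of "1 / 2 :: real"] by (simp add: ln_div)

text \<open>By contradiction from \<open>two_log_inequality\<close> with \<open>L = 8\<close> and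
  \<open>E = Y ^ 8\<close>. For \<open>l = ln Y\<close> the left side is
  \<open>32 * K * l - 4 * l\<close>, whereas the right side is at most
  \<open>13 * K * l + 5 * K\<close>: the weight gives \<open>8 * K * l\<close>, the bound
  \<open>S * N / K \<le> Y ^ 5\<close> gives \<open>5 * K * l\<close>, and the five remaining
  contributions are at most \<open>K\<close> each.\<close>

lemma two_log_bound:
  fixes p q p' q' N M G Y :: nat
  assumes pos: "p > 0" "q > 0" "p' > 0" "q' > 0" and "p \<noteq> q"
    and Y: "2 ^ 20 * (G + 1) \<le> Y" and "G > 0" "M > 0" and N: "M * Y ^ 20 \<le> N"
    and h1: "ln q \<le> 2 * M * G" and h2: "ln q' \<le> N / Y ^ 16"
    and mu: "\<bar>ln (real p / real q)\<bar> \<le> 1 / Y ^ 16"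
  shows "exp (- (M * N / Y)) \<le> \<bar>ln (real p' / real q') - N * ln (real p / real q)\<bar>"
proof (rule ccontr)
  define \<Lambda> where "\<Lambda> = ln (real p' / real q') - N * ln (real p / real q)"
  assume "\<not> ?thesis"
  then have \<Lambda>: "\<bar>\<Lambda>\<bar> \<le> exp (- (M * N / Y))" by (simp add: \<Lambda>_def)
  \<comment> \<open>\<open>K\<close> is chosen as large as the zero estimate comfortably allows,
    where \<open>2 ^ (L - 1) = 128\<close> and \<open>R + 1 - L = R - 7\<close>. It lies between
    \<open>R * S / 256\<close> and \<open>R * S / 128\<close>, so the factor
    \<open>2 ^ 12 * M * G\<close> in \<open>S\<close> makes the denominators of \<open>\<xi>\<close>
    cost at most \<open>K\<close>, and \<open>F\<close> keeps \<open>S * N / K\<close> below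
    \<open>512 * Y ^ 4\<close>.\<close>
  define F where "F = Y ^ 4"
  define R where "R = N div F"
  define S where "S = 2 ^ 12 * M * G"
  define K where "K = ((R - 7) * S) div 128"
  define l where "l = ln (real Y)"
  have YG: "2 ^ 20 * (real G + 1) \<le> real Y" 
  proof -
    have "real (2 ^ 20 * (G + 1)) \<le> real Y" using Y by (simp only: of_nat_le_iff)
    then show ?thesis by simp
  qed
  have Ybig: "2 ^ 20 \<le> real Y" using YG by simp
  then have Y1: "real Y \<ge> 1" "Y > 0" by auto
  have l10: "l \<ge> 10"
  proof -
    have "20 * ln (2::real) = ln (2 ^ 20)" using ln_realpow[of "2::real" 20] by simp
    also have "\<dots> \<le> l" unfolding l_def using Ybig by (subst ln_le_cancel_iff) auto
    finally show ?thesis using ln2_ge_half by linarith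
  qed
  have lY: "l \<le> Y" unfolding l_def using ln_le_minus_one[of "real Y"] Y1 by simp
  have YF: "Y \<le> F" "F > 0" using self_le_power[of Y 4] Y1 by (auto simp: F_def)
  have Ypow: "real Y ^ 8 = real Y ^ 4 * real Y ^ 4" "real Y ^ 16 = real Y ^ 4 * real Y ^ 12"
    "real Y ^ 16 = real Y ^ 8 * real Y ^ 8" "real F = real Y ^ 4"
    by (simp_all add: F_def flip: power_add)
  have F4: "real F = real Y * real Y * real Y * real Y" by (simp add: F_def eval_nat_numeral)
  have NF: "512 * F \<le> N"
  proof -
    have "512 * F \<le> Y * Y ^ 4" using Ybig YF by (intro mult_le_mono) (auto simp: F_def)
    also have "\<dots> = Y ^ 5" by (simp flip: power_Suc)
    also have "\<dots> \<le> Y ^ 20" using Y1 by (intro power_increasing) auto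
    also have "\<dots> \<le> M * Y ^ 20" using \<open>M > 0\<close> by simp
    finally show ?thesis using N by linarith
  qed
  have R512: "R \<ge> 512" using NF YF by (simp add: R_def less_eq_div_iff_mult_less_eq)
  have R: "real R \<le> N / F" "real N / (2 * F) \<le> R"
  proof -
    show "real R \<le> N / F" unfolding R_def by (rule of_nat_div_le_of_nat)
    have "N < F * (R + 1)" using YF by (simp add: R_def dividend_less_times_div)
    then have "real N < real (F * (R + 1))" by (simp only: of_nat_less_iff)
    then have "real N < F * (real R + 1)" by (simp add: algebra_simps)
    also have "\<dots> \<le> F * (2 * real R)" using R512 by (intro mult_left_mono) auto
    finally show "real N / (2 * F) \<le> R" using YF by (simp add: field_simps)
  qed
  have S: "S \<ge> 4096" "real S = 2 ^ 12 * M * G" using \<open>M > 0\<close> \<open>G > 0\<close>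
    by (auto simp: S_def)
  have K1: "128 * K \<le> (R - 7) * S" by (simp add: K_def)
  have K2: "real R * S \<le> 256 * real K"
  proof -
    have "(R - 7) * S < 128 * (K + 1)" by (simp add: K_def dividend_less_times_div mult.commute[of 128])
    then have "real ((R - 7) * S) < real (128 * (K + 1))" by (simp only: of_nat_less_iff)
    moreover have "real ((R - 7) * S) = real R * S - 7 * real S"
      using R512 by (simp add: of_nat_diff left_diff_distrib)
    ultimately have "real R * S - 7 * real S < 128 * real K + 128" by simp
    moreover have "512 * real S \<le> real R * S" using R512 by (intro mult_right_mono) auto
    moreover have "4096 \<le> real S" using S(1) by simp
    ultimately show ?thesis by linarith
  qed
  have K3: "128 * real K \<le> real R * S"
  proof -
    have "real (128 * K) \<le> real ((R - 7) * S)" using K1 by (simp only: of_nat_le_iff)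
    then have "128 * real K \<le> real ((R - 7) * S)" by simp
    also have "\<dots> \<le> real R * S" by (simp add: mult_right_mono)
    finally show ?thesis .
  qed
  have K32: "K \<ge> 32"
  proof -
    have "512 * 4096 \<le> real R * S" using R512 S(1) by (intro mult_mono) auto
    then show ?thesis using K2 by linarith
  qed
  have SNK: "real S * N \<le> 512 * real F * real K"
  proof -
    have "real S * N / (2 * F) \<le> real R * S"
      using mult_left_mono[OF R(2), of "real S"] by (simp add: mult.commute)
    then have "real S * N / (2 * F) \<le> 256 * K" using K2 by linarith
    then show ?thesis using YF by (simp add: field_simps)
  qed
  have "real K * 1 \<le> real R * S" using K3 by linarith
  also have "\<dots> \<le> real N * S"
  proof (intro mult_right_mono)
    have "R \<le> N" by (simp add: R_def)
    then show "real R \<le> N" by simp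
  qed simp
  finally have KSN: "K \<le> S * N" by (simp add: mult.commute flip: of_nat_mult)
  \<comment> \<open>The exponent \<open>M * N / Y\<close> is spent in two halves: one outweighs
    \<open>E ^ (8 * K) = exp (64 * K * l)\<close>, the other the factor
    \<open>16 * S\<close>.\<close>
  have small: "(real Y ^ 8) ^ (K * 8) * (2 * 8 * S * \<bar>\<Lambda>\<bar>) \<le> 1"
  proof -
    have a1: "64 * K * l \<le> M * N / (2 * Y)"
    proof -
      have "128 * real K \<le> N / F * S" using K3 R(1) mult_right_mono[of "real R" "N / F" "real S"] by linarith
      then have "64 * K * l \<le> (N / F * S) / 2 * l" using l10 by (intro mult_right_mono) auto
      also have "\<dots> \<le> (N / F * S) / 2 * Y" using lY by (intro mult_left_mono) auto
      also have "\<dots> = (M * N / (2 * Y)) * (2 ^ 12 * real G / real Y ^ 2)"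
        unfolding F4 S(2) using Y1 by (simp add: field_simps power2_eq_square)
      also have "\<dots> \<le> (M * N / (2 * Y)) * 1"
      proof (intro mult_left_mono)
        have "2 ^ 12 * real G \<le> real Y * 1" using YG by simp
        also have "\<dots> \<le> real Y ^ 2" using Y1 by (simp add: power2_eq_square)
        finally show "2 ^ 12 * real G / real Y ^ 2 \<le> 1" using Y1 by simp
      qed simp
      finally show ?thesis by simp
    qed
    have a2: "16 * real S \<le> exp (M * N / (2 * Y))"
    proof -
      have "16 * real S = real M * (2 ^ 16 * real G)" by (simp add: S(2))
      also have "\<dots> \<le> real M * (real Y ^ 20 / (2 * real Y))"
      proof (intro mult_left_mono)
        have "2 ^ 17 * real G * real Y \<le> real Y * real Y" using YG by (intro mult_right_mono) auto
        also have "\<dots> \<le> real Y ^ 20" using Y1 power_increasing[of 2 20 "real Y"] by (simp add: power2_eq_square)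
        finally show "2 ^ 16 * real G \<le> real Y ^ 20 / (2 * real Y)" using Y1 by (simp add: field_simps)
      qed simp
      also have "\<dots> \<le> real M * (real N / (2 * real Y))"
      proof (intro mult_left_mono divide_right_mono)
        have "1 * Y ^ 20 \<le> M * Y ^ 20" using \<open>M > 0\<close> by (intro mult_le_mono1) simp
        then have "Y ^ 20 \<le> N" using N by linarith
        then have "real (Y ^ 20) \<le> real N" by (simp only: of_nat_le_iff)
        then show "real Y ^ 20 \<le> real N" by simp
      qed auto
      also have "\<dots> = M * N / (2 * Y)" by simp
      also have "\<dots> \<le> exp (M * N / (2 * Y))" using exp_ge_add_one_self[of "M * N / (2 * Y)"] by linarith
      finally show ?thesis .
    qed
    have "(real Y ^ 8) ^ (K * 8) = real Y ^ (64 * K)" by (simp add: mult.commute flip: power_mult)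
    also have "\<dots> = exp (64 * K * l)" using Y1 exp_of_nat_mult[of "64 * K" l] by (simp add: l_def)
    finally have e: "(real Y ^ 8) ^ (K * 8) = exp (64 * K * l)" .
    have "(real Y ^ 8) ^ (K * 8) * (2 * 8 * S * \<bar>\<Lambda>\<bar>) = exp (64 * K * l) * (16 * S) * \<bar>\<Lambda>\<bar>"
      unfolding e by simp
    also have "\<dots> \<le> exp (M * N / (2 * Y)) * exp (M * N / (2 * Y)) * exp (- (M * N / Y))"
      using a1 a2 \<Lambda> by (intro mult_mono) auto
    also have "\<dots> = 1" by (simp flip: exp_add)
    finally show ?thesis .
  qed
  have main: "(real (K * 8) - 1) / 2 * ln (real Y ^ 8) \<le> ln (2 * real (K * 8)) + K * ln (real Y ^ 8)
     + K * (1 + ln (real (S * N) / K)) + 3 * real Y ^ 8 * real 8 * real (S * N) * (1 / Y ^ 16)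
     + real 8 * (real R * real (2 * M * G) + real S * (real N / real (Y ^ 16)))"
  proof (rule two_log_inequality[OF pos \<open>p \<noteq> q\<close>])
    show "R \<le> N" by (simp add: R_def)
    show "S > 0" using S(1) by linarith
    show "K > 0" using K32 by linarith
    show "real Y ^ 8 \<ge> 1" using Y1 by simp
    have "128 * (K - 1) < 128 * K" using K32 by linarith
    also have "\<dots> \<le> (R + 1 - 8) * S" using K1 by simp
    finally show "2 ^ (8 - 1) * (K - 1) < (R + 1 - 8) * S" by simp
    have "8 \<le> real Y" using Ybig by simp
    also have "\<dots> \<le> real Y ^ 16" using Y1 self_le_power[of "real Y" 16] by simp
    finally show "real 8 * (1 / real (Y ^ 16)) \<le> 1" using Y1 by simp
    show "(real Y ^ 8) ^ (K * 8) * (real (2 * 8 * S) * \<bar>ln (real p' / real q') - real N * ln (real p / real q)\<bar>) \<le> 1"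
      using small unfolding \<Lambda>_def by simp
  qed (use KSN mu h1 h2 in auto)
  have lnY: "ln (real Y ^ 8) = 8 * l" using Y1 by (simp add: ln_realpow l_def)
  have b1: "ln (2 * real (K * 8)) \<le> real K"
  proof -
    have "2 * real (K * 8) = 16 * real K" by simp
    also have "\<dots> \<le> 1 + real K + (real K)\<^sup>2 / 2"
    proof -
      have "32 * real K \<le> real K * K" using K32 by (intro mult_right_mono) auto
      then show ?thesis by (simp add: power2_eq_square)
    qed
    also have "\<dots> \<le> exp (real K)" by (rule exp_lower_Taylor_quadratic) simp
    finally have "ln (2 * real (K * 8)) \<le> ln (exp (real K))"
      using K32 by (subst ln_le_cancel_iff) auto
    then show ?thesis by simp
  qed
  have "ln (real (S * N) / K) \<le> 5 * l"
  proof -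
    have "real (S * N) / K \<le> 512 * F" using SNK K32 by (simp add: field_simps)
    also have "\<dots> \<le> real Y * real Y ^ 4" using Ybig Y1 by (simp add: F_def)
    also have "\<dots> = real Y ^ 5" by (simp flip: power_Suc)
    finally have "ln (real (S * N) / K) \<le> ln (real Y ^ 5)"
    proof (subst ln_le_cancel_iff)
      have "0 < S * N" using KSN K32 by linarith
      then show "0 < real (S * N) / K" using K32 by (simp del: of_nat_mult)
    qed (use Y1 in auto)
    also have "\<dots> = 5 * l" using Y1 by (simp add: ln_realpow l_def)
    finally show ?thesis .
  qed
  then have b2: "real K * (1 + ln (real (S * N) / K)) \<le> real K * (1 + 5 * l)" by (intro mult_left_mono) auto
  have b3: "3 * real Y ^ 8 * real 8 * real (S * N) * (1 / Y ^ 16) \<le> K"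
  proof -
    have "3 * real Y ^ 8 * real 8 * real (S * N) * (1 / Y ^ 16) = 24 * (real S * N) / Y ^ 8"
      unfolding of_nat_power Ypow(3) of_nat_mult of_nat_numeral using Y1 by (simp add: field_simps)
    also have "\<dots> \<le> 24 * (512 * real F * real K) / Y ^ 8" using SNK by (intro divide_right_mono mult_left_mono) auto
    also have "\<dots> = 12288 / real Y ^ 4 * real K" unfolding of_nat_power Ypow(1,4) using Y1 by (simp add: field_simps)
    also have "\<dots> \<le> 1 * real K"
    proof (intro mult_right_mono)
      have "12288 \<le> real Y" using Ybig by simp
      also have "\<dots> \<le> real Y ^ 4" using Y1 self_le_power[of "real Y" 4] by simp
      finally show "12288 / real Y ^ 4 \<le> 1" using Y1 by simp
    qed simp
    finally show ?thesis by simp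
  qed
  have b4: "8 * (real S * (N / Y ^ 16)) \<le> real K"
  proof -
    have "8 * (S * (N / Y ^ 16)) = 8 * (real S * N) / Y ^ 16" by simp
    also have "\<dots> \<le> 8 * (512 * real F * real K) / Y ^ 16" using SNK by (intro divide_right_mono mult_left_mono) auto
    also have "\<dots> = 4096 / real Y ^ 12 * real K" unfolding of_nat_power Ypow(2,4) using Y1 by (simp add: field_simps)
    also have "\<dots> \<le> 1 * real K"
    proof (intro mult_right_mono)
      have "4096 \<le> real Y" using Ybig by simp
      also have "\<dots> \<le> real Y ^ 12" using Y1 self_le_power[of "real Y" 12] by simp
      finally show "4096 / real Y ^ 12 \<le> 1" using Y1 by simp
    qed simp
    finally show ?thesis by simp
  qed
  have b5: "8 * (real R * (2 * real M * real G)) \<le> real K"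
    using K2 by (simp add: S(2) mult_ac)
  have "19 * (k * l) \<le> 4 * l + 5 * k"
    if "(8 * k - 1) / 2 * (8 * l) \<le> x1 + k * (8 * l) + x2 + x3 + 8 * (x5 + x4)"
      "x1 \<le> k" "x2 \<le> k * (1 + 5 * l)" "x3 \<le> k" "8 * x4 \<le> k" "8 * x5 \<le> k" for k x1 x2 x3 x4 x5
    using that by (simp add: algebra_simps)
  note this[OF _ b1 b2 b3 b4 b5]
  moreover have "(8 * real K - 1) / 2 * (8 * l) \<le> ln (2 * real (K * 8)) + real K * (8 * l)
     + real K * (1 + ln (real (S * N) / K)) + 3 * real Y ^ 8 * real 8 * real (S * N) * (1 / Y ^ 16)
     + 8 * (real R * (2 * real M * real G) + real S * (N / Y ^ 16))"
    using main unfolding lnY by (simp only: of_nat_mult of_nat_numeral mult_ac)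
  ultimately have "19 * (real K * l) \<le> 4 * l + 5 * real K" by blast
  moreover have "real K * 10 \<le> real K * l" using l10 by (intro mult_left_mono) auto
  moreover have "1 * l \<le> real K * l" using K32 l10 by (intro mult_right_mono) auto
  moreover have "32 \<le> real K" using K32 by simp
  ultimately show False using l10 by linarith
qed

section \<open>Linear forms in many logarithms\<close>

text \<open>Distinct naturals differ by at least one, so
  \<open>ln y - ln x \<ge> 1 - x / y \<ge> 1 / y\<close> when \<open>x < y\<close>.\<close>

lemma abs_ln_nat_diff_ge:
  fixes x y :: nat
  assumes "x > 0" "y > 0" "x \<noteq> y" "ln x \<le> h" "ln y \<le> h"
  shows "exp (- h) \<le> \<bar>ln (real x) - ln (real y)\<bar>"
proof -
  have *: "exp (- h) \<le> ln (real y) - ln (real x)" if "0 < x" "x < y" "ln y \<le> h" for x y :: nat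
  proof -
    have "exp (- h) \<le> exp (- ln y)" using that by simp
    also have "\<dots> = 1 / y" using that by (simp add: exp_minus inverse_eq_divide)
    also have "\<dots> \<le> (real y - real x) / y" using that by (intro divide_right_mono) auto
    also have "\<dots> = 1 - x / y" using that by (simp add: field_simps)
    also have "\<dots> \<le> - ln (x / y)" using ln_le_minus_one[of "x / y"] that by simp
    also have "\<dots> = ln (real y) - ln (real x)" using that by (simp add: ln_div)
    finally show ?thesis .
  qed
  show ?thesis using *[of x y] *[of y x] assms by (cases "x < y") auto
qed

lemma simultaneous_approx:
  fixes \<theta> :: "nat \<Rightarrow> real" and Q :: "nat set" and Z :: nat
  assumes "finite Q" and "Z > 0"
  obtains M f where "0 < M" "M \<le> Z ^ card Q" "\<And>q. q \<in> Q \<Longrightarrow> \<bar>real M * \<theta> q - real_of_int (f q)\<bar> < 1 / Z"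
proof -
  obtain h where h: "bij_betw h {0..<card Q} Q" using ex_bij_betw_nat_finite[OF assms(1)] by blast
  obtain m g where m: "0 < m" "m \<le> int (Z ^ card Q)"
      "\<And>i. i < card Q \<Longrightarrow> \<bar>of_int m * \<theta> (h i) - of_int (g i)\<bar> < 1 / Z"
    using Dirichlet_approx_simult[OF assms(2), where n = "card Q" and \<theta> = "\<lambda>i. \<theta> (h i)"] by metis
  let ?f = "\<lambda>q. g (inv_into {0..<card Q} h q)"
  show thesis
  proof (rule that[of "nat m" ?f])
    fix q assume "q \<in> Q"
    then obtain i where i: "i < card Q" "q = h i" using h by (force simp: bij_betw_def)
    have "inv_into {0..<card Q} h q = i" using h i by (simp add: bij_betw_def)
    then show "\<bar>real (nat m) * \<theta> q - real_of_int (?f q)\<bar> < 1 / Z" using m(3)[OF i(1)] m(1) i(2) by simp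
  qed (use m in \<open>auto simp: nat_le_iff\<close>)
qed

lemma ln_prod_power:
  fixes Q :: "nat set" and n :: "nat \<Rightarrow> nat"
  assumes "finite Q" "\<And>q. q \<in> Q \<Longrightarrow> q > 0"
  shows "ln (real (\<Prod>q\<in>Q. q ^ n q)) = (\<Sum>q\<in>Q. real (n q) * ln q)"
proof -
  have "ln (\<Prod>q\<in>Q. real q ^ n q) = (\<Sum>q\<in>Q. ln (real q ^ n q))"
    by (rule ln_prod) (use assms in auto)
  then show ?thesis using assms by (simp add: ln_realpow)
qed

lemma sum_mult_ln_le:
  fixes Q :: "nat set" and n :: "nat \<Rightarrow> real"
  assumes "finite Q" "\<And>q. q \<in> Q \<Longrightarrow> q > 0" "\<And>q. q \<in> Q \<Longrightarrow> n q \<le> c" "\<Sum>Q \<le> G" "c \<ge> 0"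
  shows "(\<Sum>q\<in>Q. n q * ln q) \<le> c * real G"
proof -
  have "(\<Sum>q\<in>Q. n q * ln q) \<le> (\<Sum>q\<in>Q. c * real q)"
  proof (rule sum_mono)
    fix q assume q: "q \<in> Q"
    have "0 \<le> ln (real q)" using assms(2)[OF q] by simp
    moreover have "ln (real q) \<le> real q" using ln_le_minus_one[of "real q"] assms(2)[OF q] by simp
    ultimately show "n q * ln q \<le> c * real q" using assms(3)[OF q] assms(5)
      by (meson mult_left_mono mult_right_mono order_trans)
  qed
  also have "\<dots> = c * real (\<Sum>Q)" by (simp add: sum_distrib_left)
  also have "\<dots> \<le> c * real G" using assms(4,5) by (intro mult_left_mono) (simp_all only: of_nat_le_iff)
  finally show ?thesis .
qed

text \<open>Reduction to \<open>two_log_bound\<close>. Because \<open>A / D\<close> occurs with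
  exponent one, it goes whole into the rational number whose logarithm is not multiplied by
  \<open>N\<close>; this is why its height may be proportional to \<open>B\<close>. The one
  parameter \<open>G\<close> bounds both the number of bases and the sum of their
  logarithms.\<close>

lemma linear_form_bound:
  fixes Q :: "nat set" and e :: "nat \<Rightarrow> int" and A D B G Y :: nat
  assumes Q: "finite Q" "\<And>q. q \<in> Q \<Longrightarrow> q > 0" "\<Sum>Q \<le> G" and "G > 0"
    and Y: "2 ^ 20 * (G + 1) \<le> Y" and B: "Y ^ (100 * (G + 1)) \<le> B"
    and A: "A > 0" "ln A \<le> B / Y ^ (100 * (G + 1))"
    and D: "D > 0" "ln D \<le> B / Y ^ (100 * (G + 1))"
    and e: "\<And>q. q \<in> Q \<Longrightarrow> \<bar>e q\<bar> \<le> int B"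
    and nz: "ln (real A) - ln (real D) + (\<Sum>q\<in>Q. e q * ln (real q)) \<noteq> 0"
  shows "exp (- (B / Y)) \<le> \<bar>ln (real A) - ln (real D) + (\<Sum>q\<in>Q. e q * ln (real q))\<bar>"
proof (rule ccontr)
  define \<Lambda> where "\<Lambda> = ln (real A) - ln (real D) + (\<Sum>q\<in>Q. e q * ln (real q))"
  assume "\<not> ?thesis"
  then have small: "\<bar>\<Lambda>\<bar> < exp (- (B / Y))" by (simp add: \<Lambda>_def)
  \<comment> \<open>One power more than the \<open>Y ^ 16\<close> of \<open>two_log_bound\<close>;
    the spare \<open>Y\<close> absorbs \<open>G\<close> and the numerical constants.\<close>
  define Z where "Z = Y ^ 17"
  have YG: "2 ^ 20 * (real G + 1) \<le> real Y" 
  proof -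
    have "real (2 ^ 20 * (G + 1)) \<le> real Y" using Y by (simp only: of_nat_le_iff)
    then show ?thesis by simp
  qed
  have Ybig: "2 ^ 20 \<le> real Y" using YG by simp
  then have Y1: "real Y \<ge> 1" "Y > 0" by auto
  have Z0: "Z > 0" using Y1 by (simp add: Z_def)
  have B0: "B > 0" using B Y1 by (metis gr0I le_zero_eq power_not_zero less_not_refl)
  obtain M f where M: "0 < M" "M \<le> Z ^ card Q"
    and f: "\<And>q. q \<in> Q \<Longrightarrow> \<bar>real M * (e q / B) - real_of_int (f q)\<bar> < 1 / Z"
    using simultaneous_approx[OF Q(1) Z0, of "\<lambda>q. e q / B"] by metis
  have "card Q \<le> \<Sum>Q" using Q(2) sum_mono[of Q "\<lambda>_. 1" "\<lambda>q. q"] by (simp add: Suc_le_eq)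
  then have "Z ^ card Q \<le> Z ^ G" using Q(3) Z0 by (intro power_increasing) auto
  then have MY: "M \<le> Y ^ (17 * G)" using M by (simp add: Z_def power_mult)
  define N where "N = B div M"
  have NM: "N * M \<le> B" by (simp add: N_def div_times_less_eq_dividend)
  have BN: "B < (N + 1) * M" using M dividend_less_div_times[of M B] by (simp add: N_def)
  \<comment> \<open>The bound \<open>M \<le> Y ^ (17 * G)\<close> enters squared, so
    \<open>B \<ge> Y ^ (34 * G + 40)\<close> is wanted, and the exponent
    \<open>100 * (G + 1)\<close> covers it.\<close>
  have N: "M * Y ^ 40 \<le> N"
  proof -
    have "M * Y ^ 40 * M \<le> Y ^ (17 * G) * Y ^ 40 * Y ^ (17 * G)"
      using MY by (intro mult_le_mono) auto
    also have "\<dots> = Y ^ (34 * G + 40)" by (simp flip: power_add)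
    also have "\<dots> \<le> Y ^ (100 * (G + 1))" using Y1 by (intro power_increasing) auto
    finally have "M * Y ^ 40 * M \<le> B" using B by linarith
    then show ?thesis using M by (simp add: N_def less_eq_div_iff_mult_less_eq)
  qed
  have N': "Y ^ 40 \<le> N" using N M by (metis One_nat_def Suc_leI mult_le_mono1 nat_mult_1 order_trans)
  have N0: "N > 0" using N' Y1 by (metis gr0I le_zero_eq power_not_zero less_not_refl)
  have BNM: "real B / M \<le> N + 1" "real N \<le> real B / M"
  proof -
    have "real B \<le> real ((N + 1) * M)" using BN by (simp only: of_nat_le_iff less_imp_le)
    then have "real B \<le> (real N + 1) * M" by (simp add: algebra_simps)
    then show "real B / M \<le> N + 1" using M by (simp add: field_simps)
    have "real (N * M) \<le> B" using NM by (simp only: of_nat_le_iff)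
    then have "real N * M \<le> B" by simp
    then show "real N \<le> real B / M" using M by (simp add: field_simps)
  qed
  have fM: "\<bar>real_of_int (f q)\<bar> \<le> M + 1" if q: "q \<in> Q" for q
  proof -
    have "\<bar>real_of_int (e q) / B\<bar> \<le> 1" using e[OF q] B0 by (simp add: abs_divide)
    then have "\<bar>real M * (e q / B)\<bar> \<le> real M * 1" unfolding abs_mult by (intro mult_mono) auto
    moreover have "1 / real Z \<le> 1" using Z0 by simp
    ultimately show ?thesis using f[OF q] by linarith
  qed
  \<comment> \<open>\<open>e q / B\<close> is near \<open>f q / M\<close> and \<open>B / M\<close>
    is near \<open>N\<close>, so the remainder \<open>g q\<close> has size about
    \<open>N / Z\<close>, while \<open>f q\<close> has size about \<open>M\<close>.\<close>
  define g where "g q = e q - int N * f q" for q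
  have ge: "e q = g q + int N * f q" for q by (simp add: g_def)
  have NZ: "real M + 1 + 1 / Z \<le> N / Z"
  proof -
    have "(M + 2) * Z \<le> 3 * M * Y ^ 17" using M by (intro mult_le_mono) (auto simp: Z_def)
    also have "\<dots> \<le> Y * M * Y ^ 17" using Ybig by (intro mult_le_mono) auto
    also have "\<dots> = M * Y ^ 18" by (simp flip: power_Suc)
    also have "\<dots> \<le> M * Y ^ 40" using Y1 by (intro mult_le_mono power_increasing) auto
    also have "\<dots> \<le> N" by (rule N)
    finally have "real ((M + 2) * Z) \<le> real N" by (simp only: of_nat_le_iff)
    then have "(real M + 2) * Z \<le> N" by (simp add: algebra_simps)
    then have "real M + 2 \<le> N / Z" using Z0 by (simp add: field_simps)
    moreover have "1 / real Z \<le> 1" using Z0 by simp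
    ultimately show ?thesis by linarith
  qed
  have gN: "\<bar>real_of_int (g q)\<bar> \<le> 2 * real N / Z" if q: "q \<in> Q" for q
  proof -
    define d where "d = real M * (e q / B) - f q"
    have d: "\<bar>d\<bar> \<le> 1 / Z" using f[OF q] by (simp add: d_def)
    define c where "c = real B / M"
    have c: "0 \<le> c" "c \<le> real N + 1" "real N \<le> c" using BNM by (simp_all add: c_def)
    have "real_of_int (e q) = c * (f q + d)" using M B0 by (simp add: d_def c_def)
    then have "real_of_int (g q) = (c - N) * f q + c * d"
      by (simp add: g_def algebra_simps)
    also have "\<bar>\<dots>\<bar> \<le> \<bar>(c - N) * f q\<bar> + \<bar>c * d\<bar>" by (rule abs_triangle_ineq)
    also have "\<dots> \<le> 1 * (real M + 1) + (real N + 1) * (1 / Z)"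
      unfolding abs_mult using c fM[OF q] d by (intro add_mono mult_mono) auto
    also have "\<dots> \<le> 2 * real N / Z" using NZ by (simp add: add_divide_distrib)
    finally show ?thesis .
  qed
  \<comment> \<open>\<open>nat\<close> sends negative values to zero, so numerator and denominator
    collect the exponents of opposite sign. The signs of \<open>f\<close> are reversed in
    \<open>p / q0\<close> because this number enters the form with coefficient
    \<open>- N\<close>.\<close>
  define p where "p = (\<Prod>q\<in>Q. q ^ nat (- f q))"
  define q0 where "q0 = (\<Prod>q\<in>Q. q ^ nat (f q))"
  define p' where "p' = A * (\<Prod>q\<in>Q. q ^ nat (g q))"
  define q' where "q' = D * (\<Prod>q\<in>Q. q ^ nat (- g q))"
  have pos: "p > 0" "q0 > 0" "p' > 0" "q' > 0"
    using Q A D by (auto simp: p_def q0_def p'_def q'_def intro!: prod_pos)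
  have natdiff': "real (nat (- x)) - real (nat x) = - real_of_int x" for x :: int by (cases "x \<ge> 0") auto
  have natdiff: "real (nat x) - real (nat (- x)) = real_of_int x" for x :: int by (cases "x \<ge> 0") auto
  have lnp: "ln (real p / real q0) = - (\<Sum>q\<in>Q. f q * ln (real q))"
  proof -
    have "ln (real p / real q0) = (\<Sum>q\<in>Q. real (nat (- f q)) * ln q) - (\<Sum>q\<in>Q. real (nat (f q)) * ln q)"
    proof -
      have "ln (real p) = (\<Sum>q\<in>Q. real (nat (- f q)) * ln q)" "ln (real q0) = (\<Sum>q\<in>Q. real (nat (f q)) * ln q)"
        unfolding p_def q0_def by (rule ln_prod_power[OF Q(1,2)], assumption)+
      then show ?thesis using pos by (simp add: ln_div)
    qed
    also have "\<dots> = (\<Sum>q\<in>Q. - (f q * ln (real q)))"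
      unfolding sum_subtractf[symmetric] left_diff_distrib[symmetric] natdiff' by simp
    finally show ?thesis by (simp add: sum_negf)
  qed
  have lnp': "ln (real p') = ln A + (\<Sum>q\<in>Q. real (nat (g q)) * ln q)"
  proof -
    have "(\<Prod>q\<in>Q. q ^ nat (g q)) > 0" using Q by (auto intro!: prod_pos)
    then have "ln (real p') = ln A + ln (real (\<Prod>q\<in>Q. q ^ nat (g q)))"
      unfolding p'_def using A by (simp add: ln_mult del: of_nat_prod)
    also have "ln (real (\<Prod>q\<in>Q. q ^ nat (g q))) = (\<Sum>q\<in>Q. real (nat (g q)) * ln q)"
      by (rule ln_prod_power[OF Q(1,2)])
    finally show ?thesis .
  qed
  have lnq': "ln (real q') = ln D + (\<Sum>q\<in>Q. real (nat (- g q)) * ln q)"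
  proof -
    have "(\<Prod>q\<in>Q. q ^ nat (- g q)) > 0" using Q by (auto intro!: prod_pos)
    then have "ln (real q') = ln D + ln (real (\<Prod>q\<in>Q. q ^ nat (- g q)))"
      unfolding q'_def using D by (simp add: ln_mult del: of_nat_prod)
    also have "ln (real (\<Prod>q\<in>Q. q ^ nat (- g q))) = (\<Sum>q\<in>Q. real (nat (- g q)) * ln q)"
      by (rule ln_prod_power[OF Q(1,2)])
    finally show ?thesis .
  qed
  have lna: "ln (real p' / real q') = ln A - ln D + (\<Sum>q\<in>Q. g q * ln (real q))"
  proof -
    have "ln (real p' / real q') = ln A - ln D + ((\<Sum>q\<in>Q. real (nat (g q)) * ln q) - (\<Sum>q\<in>Q. real (nat (- g q)) * ln q))"
      using pos by (simp add: ln_div lnp' lnq')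
    also have "(\<Sum>q\<in>Q. real (nat (g q)) * ln q) - (\<Sum>q\<in>Q. real (nat (- g q)) * ln q) = (\<Sum>q\<in>Q. g q * ln (real q))"
      unfolding sum_subtractf[symmetric] left_diff_distrib[symmetric] natdiff by simp
    finally show ?thesis .
  qed
  have form: "\<Lambda> = ln (real p' / real q') - N * ln (real p / real q0)"
    unfolding \<Lambda>_def lna lnp ge
    by (simp add: sum.distrib sum_distrib_left distrib_right mult.assoc)
  \<comment> \<open>The factor two is kept in reserve for the estimate of
    \<open>ln (p / q0)\<close>, where \<open>\<bar>\<Lambda>\<bar> \<le> 1\<close> must fit in as
    well.\<close>
  have height: "B / real Y ^ (100 * (G + 1)) + 2 * real N / Z * G \<le> N / (2 * Y ^ 16)"
  proof -
    have "real B \<le> 2 * real N * real M"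
    proof -
      have "(N + 1) * M \<le> (2 * N) * M" using N0 by (intro mult_le_mono1) linarith
      then have "real B \<le> real (2 * N * M)" using BN by (simp only: of_nat_le_iff)
      then show ?thesis by simp
    qed
    also have "\<dots> \<le> 2 * real N * real Y ^ (17 * G)"
    proof (intro mult_left_mono)
      have "real M \<le> real (Y ^ (17 * G))" using MY by (simp only: of_nat_le_iff)
      then show "real M \<le> real Y ^ (17 * G)" by simp
    qed simp
    finally have "B / real Y ^ (100 * (G + 1)) \<le> 2 * real N * real Y ^ (17 * G) / real Y ^ (100 * (G + 1))"
      by (intro divide_right_mono) auto
    also have "\<dots> \<le> 2 * real N * real Y ^ (17 * G) / real Y ^ (17 * G + 17)"
      using Y1 N0 by (intro divide_left_mono power_increasing) auto
    also have "\<dots> = 2 * real N / real Y ^ 17" using Y1 by (simp add: power_add)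
    finally have "B / real Y ^ (100 * (G + 1)) + 2 * real N / Z * G \<le> 2 * real N / real Y ^ 17 + 2 * real N / Z * G"
      by simp
    also have "\<dots> = (4 * (real G + 1)) / Y * (N / (2 * Y ^ 16))"
    proof -
      have "real Z = real Y * real Y ^ 16" "real Y ^ 17 = real Y * real Y ^ 16"
        by (simp_all add: Z_def flip: power_Suc)
      then show ?thesis using Y1 by (simp add: field_simps)
    qed
    also have "\<dots> \<le> 1 * (N / (2 * Y ^ 16))"
      using YG Y1 by (intro mult_right_mono) auto
    finally show ?thesis by simp
  qed
  have hp': "ln (real p') \<le> N / (2 * Y ^ 16)"
  proof -
    have "(\<Sum>q\<in>Q. real (nat (g q)) * ln q) \<le> 2 * real N / Z * G"
    proof (rule sum_mult_ln_le[OF Q(1,2) _ Q(3)])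
      show "real (nat (g q)) \<le> 2 * real N / Z" if "q \<in> Q" for q using gN[OF that] by (cases "g q \<ge> 0") auto
    qed auto
    moreover have "ln A \<le> B / real Y ^ (100 * (G + 1))" using A by simp
    ultimately show ?thesis using lnp' height by linarith
  qed
  have hq': "ln (real q') \<le> N / (2 * Y ^ 16)"
  proof -
    have "(\<Sum>q\<in>Q. real (nat (- g q)) * ln q) \<le> 2 * real N / Z * G"
    proof (rule sum_mult_ln_le[OF Q(1,2) _ Q(3)])
      show "real (nat (- g q)) \<le> 2 * real N / Z" if "q \<in> Q" for q using gN[OF that] by (cases "g q \<ge> 0") auto
    qed auto
    moreover have "ln D \<le> B / real Y ^ (100 * (G + 1))" using D by simp
    ultimately show ?thesis using lnq' height by linarith
  qed
  have MNB: "exp (- (B / Y)) \<le> exp (- (M * N / Y))"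
    using NM Y1 by (simp add: divide_right_mono mult.commute flip: of_nat_mult)
  show False
  proof (cases "p = q0")
    \<comment> \<open>Here \<open>\<xi> = 1\<close>, which \<open>two_log_bound\<close> excludes,
      but then the form is a difference of logarithms of two naturals.\<close>
    case True
    then have L: "\<Lambda> = ln (real p') - ln (real q')" using form pos by (simp add: ln_div)
    then have "p' \<noteq> q'" using nz by (auto simp: \<Lambda>_def)
    then have "exp (- (N / (2 * Y ^ 16))) \<le> \<bar>\<Lambda>\<bar>"
      unfolding L by (intro abs_ln_nat_diff_ge pos hp' hq')
    moreover have "exp (- (M * N / Y)) \<le> exp (- (N / (2 * Y ^ 16)))"
    proof -
      have "N / (2 * Y ^ 16) \<le> real N / Y"
      proof (intro divide_left_mono)
        have "real Y \<le> real Y ^ 16" using Y1 self_le_power[of "real Y" 16] by simp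
        also have "\<dots> \<le> 2 * real Y ^ 16" by simp
        finally show "real Y \<le> real (2 * Y ^ 16)" by simp
      qed (use Y1 in auto)
      also have "\<dots> \<le> M * N / Y"
      proof (intro divide_right_mono)
        have "1 * N \<le> M * N" using M by (intro mult_le_mono1) simp
        then show "real N \<le> real (M * N)" by (simp only: of_nat_le_iff mult_1)
      qed simp
      finally show ?thesis by simp
    qed
    ultimately show False using MNB small by linarith
  next
    case False
    have "exp (- (M * N / Y)) \<le> \<bar>ln (real p' / real q') - N * ln (real p / real q0)\<bar>"
    proof (rule two_log_bound[OF pos False Y \<open>G > 0\<close> M(1)])
      have "M * Y ^ 20 \<le> M * Y ^ 40" using Y1 by (intro mult_le_mono power_increasing) auto
      then show "M * Y ^ 20 \<le> N" using N by linarith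
      have "ln (real q0) = (\<Sum>q\<in>Q. real (nat (f q)) * ln q)"
        unfolding q0_def by (rule ln_prod_power[OF Q(1,2)])
      also have "\<dots> \<le> (real M + 1) * G"
      proof (rule sum_mult_ln_le[OF Q(1,2) _ Q(3)])
        show "real (nat (f q)) \<le> real M + 1" if "q \<in> Q" for q using fM[OF that] by (cases "f q \<ge> 0") auto
      qed auto
      also have "\<dots> \<le> 2 * real M * real G" using M by (intro mult_right_mono) auto
      finally show "ln (real q0) \<le> real (2 * M * G)" by simp
      have half: "real N / (2 * Y ^ 16) \<le> N / Y ^ 16" using Y1 by (intro divide_left_mono) auto
      then show "ln (real q') \<le> real N / real (Y ^ 16)" using hq' by simp
      have "ln (real p' / real q') = ln (real p') - ln (real q')" using pos by (simp add: ln_div)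
      moreover have "ln (real p') \<ge> 0" "ln (real q') \<ge> 0" using pos by auto
      \<comment> \<open>That \<open>p / q0\<close> is close to one is a consequence: both
        \<open>\<Lambda>\<close> and \<open>ln (p' / q')\<close> are small compared with
        \<open>N\<close>.\<close>
      ultimately have "\<bar>ln (real p' / real q')\<bar> \<le> N / (2 * Y ^ 16)"
        using hp' hq' by linarith
      moreover have "\<bar>\<Lambda>\<bar> \<le> 1"
      proof -
        have "exp (- (B / Y)) \<le> 1" by simp
        then show ?thesis using small by linarith
      qed
      ultimately have "\<bar>N * ln (real p / real q0)\<bar> \<le> N / (2 * Y ^ 16) + 1" using form by linarith
      also have "\<dots> \<le> N / (2 * Y ^ 16) + N / (2 * Y ^ 16)"
      proof -
        have "2 * Y ^ 16 \<le> Y * Y ^ 16" using Ybig by (intro mult_le_mono1) auto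
        also have "\<dots> = Y ^ 17" by (simp flip: power_Suc)
        also have "\<dots> \<le> Y ^ 40" using Y1 by (intro power_increasing) auto
        finally have "2 * Y ^ 16 \<le> N" using N' by linarith
        then have "real (2 * Y ^ 16) \<le> N" by (simp only: of_nat_le_iff)
        then have "1 \<le> N / real (2 * Y ^ 16)" using Y1 by (simp add: field_simps)
        then show ?thesis by linarith
      qed
      also have "\<dots> = N * (1 / Y ^ 16)" by simp
      finally have "real N * \<bar>ln (real p / real q0)\<bar> \<le> N * (1 / Y ^ 16)" by (simp add: abs_mult)
      then show "\<bar>ln (real p / real q0)\<bar> \<le> 1 / real (Y ^ 16)" using N0 by (subst (asm) mult_le_cancel_left_pos) auto
    qed
    then show False using MNB small form by linarith
  qed
qed

section \<open>Sparse integers\<close>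

lemma S_part_dvd:
  assumes "finite S" "\<And>q. q \<in> S \<Longrightarrow> prime q"
  shows "S_part S n dvd n"
  using assms
proof (induction S rule: finite_induct)
  case (insert q S)
  have "coprime (q ^ multiplicity q n) (S_part S n)"
    unfolding S_part_def
  proof (intro prod_coprime_right)
    fix r assume "r \<in> S"
    then have "coprime q r" using insert by (intro primes_coprime) auto
    then show "coprime (q ^ multiplicity q n) (r ^ multiplicity r n)" by simp
  qed
  moreover have "S_part S n dvd n" using insert by blast
  ultimately have "q ^ multiplicity q n * S_part S n dvd n"
    by (intro divides_mult multiplicity_dvd)
  then show ?case using insert by (simp add: S_part_def)
qed (simp add: S_part_def)

section \<open>Gaps between the nonzero digits\<close>

lemma mod_power_eq_if_no_digits:
  assumes "v \<le> w" "\<And>j. v \<le> j \<Longrightarrow> j < w \<Longrightarrow> digit b n j = 0"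
  shows "n mod b ^ w = n mod b ^ v"
  using assms
proof (induction w rule: dec_induct)
  case (step w)
  have "n mod b ^ Suc w = b ^ w * digit b n w + n mod b ^ w"
    unfolding digit_def power_Suc2 by (rule mod_mult2_eq)
  then show ?case using step by simp
qed simp

text \<open>Pigeonhole: the digit at position 0 is nonzero because \<open>b\<close> does not divide
  \<open>n\<close>, and it lies below all the ranges because \<open>w 0 > 0\<close>. One nonzero
  digit in each of the \<open>k\<close> ranges would bring the count to
  \<open>k + 1\<close>.\<close>

lemma digit_free_gap:
  fixes w :: "nat \<Rightarrow> nat"
  assumes "n \<in> sparse_set b k" "b \<ge> 2" "mono w" "w 0 > 0"
  shows "\<exists>i<k. \<forall>j. w i \<le> j \<longrightarrow> j < w (Suc i) \<longrightarrow> digit b n j = 0"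
proof (rule ccontr)
  assume "\<not> ?thesis"
  then have "\<forall>i<k. \<exists>j. w i \<le> j \<and> j < w (Suc i) \<and> digit b n j \<noteq> 0" by blast
  then obtain d where d: "\<And>i. i < k \<Longrightarrow> w i \<le> d i" "\<And>i. i < k \<Longrightarrow> d i < w (Suc i)"
      "\<And>i. i < k \<Longrightarrow> digit b n (d i) \<noteq> 0"
    by metis
  have lt: "d i < d j" if "i < j" "j < k" for i j
  proof -
    have "d i < w (Suc i)" using d(2) that by simp
    also have "\<dots> \<le> w j" using that by (intro monoD[OF assms(3)]) simp
    also have "\<dots> \<le> d j" using d(1) that by simp
    finally show ?thesis .
  qed
  have inj: "inj_on d {..<k}"
  proof (rule inj_onI)
    fix i j assume "i \<in> {..<k}" "j \<in> {..<k}" "d i = d j"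
    then show "i = j" using lt[of i j] lt[of j i] by (cases i j rule: linorder_cases) auto
  qed
  have d0: "d i > 0" if "i < k" for i
    using d(1)[OF that] monoD[OF assms(3), of 0 i] assms(4) by simp
  have "digit b n 0 \<noteq> 0" using assms(1) by (simp add: digit_def sparse_set_def mod_eq_0_iff_dvd)
  then have "insert 0 (d ` {..<k}) \<subseteq> {i. digit b n i \<noteq> 0}" using d(3) by auto
  then have "card (insert 0 (d ` {..<k})) \<le> card {i. digit b n i \<noteq> 0}"
    by (intro card_mono finite_nonzero_digits[OF assms(2)])
  also have "\<dots> \<le> k" using assms(1) by (simp add: sparse_set_def)
  also have "card (insert 0 (d ` {..<k})) = Suc k"
    using d0 inj by (subst card_insert_disjoint) (force simp: card_image)+
  finally show False by simp
qed

text \<open>The \<open>i\<close>-th range of positions, counted from the top, ends at distance \<open>B div scale G i\<close>.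
  Up to constants, each scale is the square of the power of the previous one that
  \<open>linear_form_bound\<close> asks for.\<close>

definition scale :: "nat \<Rightarrow> nat \<Rightarrow> nat" where
  "scale G i = (2 ^ 20 * (G + 1)) ^ ((200 * (G + 1)) ^ i)"

lemma scale_Suc: "scale G (Suc i) = (scale G i ^ (100 * (G + 1)))\<^sup>2"
  by (simp add: scale_def mult_ac flip: power_mult)

lemma scale_mono: "i \<le> j \<Longrightarrow> scale G i \<le> scale G j"
  unfolding scale_def by (intro power_increasing) auto

text \<open>If the \<open>S\<close>-part were larger, the cofactor \<open>A\<close> would satisfy
  \<open>ln A \<le> ln n / 2 ^ V k\<close>. A digit-free range then gives a positive form below
  \<open>exp (- (B / (4 * V i)))\<close>, against \<open>linear_form_bound\<close> with
  \<open>Y = 4 * V i\<close>. The number \<open>2 ^ V k\<close> only has to exceed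
  \<open>(4 * V i) ^ P\<close> for the unknown \<open>i < k\<close>; a power of two makes the
  constant easy to approximate by dyadic numbers.\<close>

lemma S_part_sparse_le:
  fixes b k n :: nat and S :: "nat set"
  defines "V \<equiv> scale (b + set_encode S)"
  assumes b: "b \<ge> 2" and S: "finite S" "\<And>q. q \<in> S \<Longrightarrow> prime q"
    and n: "n \<in> sparse_set b k" "b ^ V k \<le> n"
  shows "real (S_part S n) \<le> real n powr (1 - 1 / 2 ^ V k)"
proof (rule ccontr)
  assume "\<not> ?thesis"
  then have large: "real n powr (1 - 1 / 2 ^ V k) < real (S_part S n)" by simp
  define G where "G = b + set_encode S"
  define P where "P = 100 * (G + 1)"
  have V: "V = scale G" by (simp add: V_def G_def)
  have V0: "2 ^ 20 * (G + 1) \<le> V i" for i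
    using scale_mono[of 0 i G] by (simp add: V scale_def)
  have bV: "8 * b \<le> V i" for i
  proof -
    have "8 * b \<le> 2 ^ 20 * (G + 1)" by (simp add: G_def)
    then show ?thesis using V0 order_trans by blast
  qed
  have Vmono: "V i \<le> V j" if "i \<le> j" for i j using scale_mono[OF that] by (simp add: V)
  have VS: "V (Suc i) = (V i ^ P)\<^sup>2" for i by (simp add: V P_def scale_Suc)
  have Vpos: "V i > 0" for i using bV[of i] b by simp
  have n0: "n > 0" using n(1) by (simp add: sparse_set_def)
  obtain m where m: "b ^ m \<le> n" "n < b ^ (m + 1)" using ex_power_ivl1[OF b, of n] n0 by auto
  have mV: "V k \<le> m"
  proof -
    have "b ^ V k < b ^ (m + 1)" using n(2) m(2) by linarith
    then show ?thesis using b power_less_imp_less_exp[of b "V k" "m + 1"] by simp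
  qed
  \<comment> \<open>One number dominating everything: \<open>W \<le> m\<close>, the multiplicities
    of primes in \<open>n < b ^ (m + 1) \<le> 2 ^ B\<close>, and \<open>ln n\<close>.\<close>
  define B where "B = b * (m + 1)"
  have Bm: "2 * m \<le> B" using b mult_le_mono[of 2 b m "m + 1"] by (simp add: B_def)
  have BV: "2 * V i \<le> B" if "i \<le> k" for i using Vmono[OF that] mV Bm by linarith
  have Bdiv: "B div V i < m" for i
  proof -
    have "B div V i \<le> B div (8 * b)" using bV[of i] b by (intro div_le_mono2) auto
    also have "\<dots> = (m + 1) div 8" unfolding B_def mult.commute[of 8] using b by (subst div_mult_mult1) auto
    also have "\<dots> < m" using mV bV[of k] b by linarith
    finally show ?thesis .
  qed
  \<comment> \<open>\<open>m\<close> is the position of the leading digit. By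
    \<open>B div V i < m\<close> the subtraction is exact and every \<open>w i\<close> is
    positive.\<close>
  define w where "w i = m - B div V i" for i
  have "mono w"
  proof (rule monoI)
    fix i j :: nat assume "i \<le> j"
    then have "B div V j \<le> B div V i" using Vmono Vpos by (intro div_le_mono2) auto
    then show "w i \<le> w j" by (simp add: w_def)
  qed
  moreover have "w 0 > 0" using Bdiv[of 0] by (simp add: w_def)
  ultimately obtain i where i: "i < k" "\<And>j. w i \<le> j \<Longrightarrow> j < w (Suc i) \<Longrightarrow> digit b n j = 0"
    using digit_free_gap[OF n(1) b, of w] by blast
  have ww: "w i \<le> w (Suc i)" using \<open>mono w\<close> by (simp add: monoD)
  define W where "W = w (Suc i)"
  have W: "W > 0" "W \<le> m" using Bdiv[of "Suc i"] by (simp_all add: W_def w_def)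
  \<comment> \<open>\<open>D\<close> carries the digits above the empty range and \<open>r\<close>
    those below it, so that \<open>r < b ^ w i\<close> although only a reduction modulo
    \<open>b ^ W\<close> is made.\<close>
  define D where "D = n div b ^ W"
  define r where "r = n mod b ^ W"
  have nD: "n = D * b ^ W + r" unfolding D_def r_def by (rule div_mult_mod_eq[symmetric])
  have bp: "b ^ x > 0" for x using b by simp
  have r: "r < b ^ w i"
    using mod_power_eq_if_no_digits[OF ww i(2)] bp[of "w i"] by (simp add: r_def W_def)
  have "r \<noteq> 0"
  proof
    assume "r = 0"
    then have "b ^ W dvd n" by (simp add: r_def mod_eq_0_iff_dvd)
    then have "b dvd n" using W(1) dvd_power[of W b] dvd_trans by blast
    then show False using n(1) by (simp add: sparse_set_def)
  qed
  have "b ^ (m - W) = b ^ m div b ^ W" using W b by (simp add: power_diff)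
  also have "\<dots> \<le> D" unfolding D_def by (rule div_le_mono[OF m(1)])
  finally have Dl: "b ^ (m - W) \<le> D" .
  then have D0: "D > 0" using bp[of "m - W"] by linarith
  have DbW: "b ^ m \<le> D * b ^ W"
  proof -
    have "b ^ m = b ^ (m - W) * b ^ W" using W by (simp flip: power_add)
    also have "\<dots> \<le> D * b ^ W" using Dl by (rule mult_le_mono1)
    finally show ?thesis .
  qed
  have Du: "D < b ^ (B div V (Suc i) + 1)"
  proof -
    have "m + 1 = B div V (Suc i) + 1 + W" using Bdiv[of "Suc i"] by (simp add: W_def w_def)
    then have "n < b ^ (B div V (Suc i) + 1) * b ^ W" using m(2) by (metis power_add)
    then show ?thesis unfolding D_def using bp by (simp add: less_mult_imp_div_less)
  qed
  define sp where "sp = S_part S n"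
  have spd: "sp dvd n" unfolding sp_def by (rule S_part_dvd[OF S])
  define A where "A = n div sp"
  have nA: "n = A * sp" using spd by (simp add: A_def)
  have A0: "A > 0" and sp0: "sp > 0" using n0 nA by auto
  define Q where "Q = insert b S"
  \<comment> \<open>The base \<open>b\<close> may itself lie in \<open>S\<close>; its multiplicity
    and \<open>- W\<close> are then combined into one exponent.\<close>
  define e where "e q = (if q \<in> S then int (multiplicity q n) else 0) - (if q = b then int W else 0)" for q
  define \<Lambda> where "\<Lambda> = ln (real A) - ln (real D) + (\<Sum>q\<in>Q. e q * ln (real q))"
  have Q: "finite Q" "\<And>q. q \<in> Q \<Longrightarrow> q > 0" using S b by (auto simp: Q_def prime_gt_0_nat)
  have "\<Lambda> = ln (real n) - ln (real D * real b ^ W)"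
  proof -
    have "(\<Sum>q\<in>Q. e q * ln (real q)) = (\<Sum>q\<in>Q. if q \<in> S then real (multiplicity q n) * ln q else 0)
        - (\<Sum>q\<in>Q. if q = b then real W * ln b else 0)"
      unfolding sum_subtractf[symmetric] by (intro sum.cong refl) (auto simp: e_def algebra_simps)
    also have "(\<Sum>q\<in>Q. if q \<in> S then real (multiplicity q n) * ln q else 0) = (\<Sum>q\<in>S. real (multiplicity q n) * ln q)"
      using Q(1) by (subst sum.inter_restrict[symmetric]) (auto simp: Q_def intro!: sum.cong)
    also have "\<dots> = (\<Sum>q\<in>S. ln (real q ^ multiplicity q n))"
      using S(2) by (intro sum.cong) (auto simp: ln_realpow prime_gt_0_nat)
    also have "\<dots> = ln (\<Prod>q\<in>S. real q ^ multiplicity q n)"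
      using S by (intro ln_prod[symmetric]) (auto simp: prime_gt_0_nat)
    also have "\<dots> = ln (real sp)" by (simp add: sp_def S_part_def)
    also have "(\<Sum>q\<in>Q. if q = b then real W * ln b else 0) = W * ln b"
      using Q(1) by (simp add: Q_def)
    finally have "\<Lambda> = ln (real A) + ln (real sp) - (ln (real D) + W * ln b)" by (simp add: \<Lambda>_def)
    also have "ln (real A) + ln (real sp) = ln (real n)" using A0 sp0 by (subst nA) (simp add: ln_mult)
    also have "ln (real D) + W * ln b = ln (real D * real b ^ W)"
      using D0 b by (simp add: ln_mult ln_realpow)
    finally show ?thesis .
  qed
  also have "\<dots> = ln (1 + r / (real D * real b ^ W))"
  proof -
    have "1 + r / (real D * real b ^ W) = real n / (real D * real b ^ W)"
      using D0 b by (subst nD) (simp add: field_simps)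
    then show ?thesis using D0 b n0 by (simp add: ln_div)
  qed
  finally have \<Lambda>: "\<Lambda> = ln (1 + r / (real D * real b ^ W))" .
  have x0: "r / (real D * real b ^ W) > 0" using \<open>r \<noteq> 0\<close> D0 b by simp
  then have \<Lambda>0: "\<Lambda> > 0" unfolding \<Lambda> by (intro ln_gt_zero) linarith
  have "\<Lambda> \<le> r / (real D * real b ^ W)" unfolding \<Lambda> using x0 by (intro ln_add_one_self_le_self) linarith
  also have "\<dots> \<le> real b ^ w i / real b ^ m"
  proof (intro frac_le)
    show "real r \<le> real b ^ w i" using r by (simp flip: of_nat_power)
    show "real b ^ m \<le> real D * real b ^ W" using DbW by (simp flip: of_nat_power of_nat_mult)
  qed (use b in auto)
  also have "\<dots> = 1 / real b ^ (B div V i)"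
  proof -
    have "m = w i + B div V i" using Bdiv[of i] by (simp add: w_def)
    then have "real b ^ m = real b ^ w i * real b ^ (B div V i)" by (metis power_add)
    then show ?thesis using b by simp
  qed
  also have "\<dots> \<le> 1 / 2 ^ (B div V i)"
    using b by (intro divide_left_mono power_mono) auto
  also have "\<dots> = exp (- (real (B div V i) * ln 2))"
    by (simp add: exp_minus exp_of_nat_mult inverse_eq_divide)
  \<comment> \<open>The rounding in \<open>B div V i\<close> and the bound
    \<open>ln 2 \<ge> 1 / 2\<close> cost at most a factor two each, whence
    \<open>4 * V i\<close>.\<close>
  also have "\<dots> < exp (- (B / (4 * V i)))"
  proof -
    define x where "x = real B / V i"
    have "2 * real (V i) \<le> real B" using BV[of i] i(1) by (simp flip: of_nat_mult)
    then have x2: "x \<ge> 2" using Vpos[of i] by (simp add: x_def field_simps)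
    have "x - 1 < real (B div V i)"
      unfolding x_def using divide_nat_diff_div_nat_less_one[of B "V i"] by linarith
    then have "(x - 1) * (1 / 2) < real (B div V i) * ln 2"
      using ln2_ge_half x2 by (intro mult_less_le_imp_less) auto
    moreover have "B / (4 * V i) = x / 4" by (simp add: x_def)
    ultimately show ?thesis using x2 by simp
  qed
  finally have upper: "\<Lambda> < exp (- (B / real (4 * V i)))" by simp

  \<comment> \<open>The square in \<open>scale_Suc\<close> is used here: its second factor
    \<open>V i ^ P\<close> absorbs \<open>(8 * b) ^ P\<close>. This makes \<open>D\<close> short
    enough for \<open>linear_form_bound\<close>.\<close>
  have Yp: "2 * b * (4 * V i) ^ P \<le> V (Suc i)"
  proof -
    have "2 * b * (4 * V i) ^ P \<le> (2 * b) ^ P * (4 * V i) ^ P"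
      using b by (intro mult_le_mono1 self_le_power) (auto simp: P_def)
    also have "\<dots> = (8 * b) ^ P * V i ^ P" by (simp only: power_mult_distrib[symmetric]) (simp add: mult_ac)
    also have "\<dots> \<le> V i ^ P * V i ^ P" using bV by (intro mult_le_mono1 power_mono) auto
    finally show ?thesis by (simp add: VS power2_eq_square)
  qed
  have Yp0: "(4 * V i) ^ P > 0" using Vpos by simp
  have Yp': "(4 * V i) ^ P \<le> V (Suc i)"
  proof -
    have "1 * (4 * V i) ^ P \<le> 2 * b * (4 * V i) ^ P" using b by (intro mult_le_mono1) auto
    then show ?thesis using Yp by linarith
  qed
  have lnb: "0 \<le> ln (real b)" "ln (real b) \<le> b" using b ln_le_minus_one[of "real b"] by auto
  have "exp (- (B / real (4 * V i))) \<le> \<bar>\<Lambda>\<bar>"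
    unfolding \<Lambda>_def
  proof (rule linear_form_bound[OF Q])
    show "G > 0" using b by (simp add: G_def)
    have "\<Sum>Q \<le> b + \<Sum>S" using S(1) by (simp add: Q_def sum.insert_if)
    also have "\<Sum>S \<le> set_encode S" unfolding set_encode_def by (intro sum_mono) (simp add: less_imp_le)
    finally show "\<Sum>Q \<le> G" by (simp add: G_def)
    show "2 ^ 20 * (G + 1) \<le> 4 * V i" using V0[of i] by linarith
    show "(4 * V i) ^ (100 * (G + 1)) \<le> B"
      using Yp' BV[of "Suc i"] i(1) by (simp add: P_def)
    show "A > 0" "D > 0" by fact+
    show "\<bar>e q\<bar> \<le> int B" if "q \<in> Q" for q
    proof -
      have "W \<le> B" using W Bm by linarith
      moreover have "multiplicity q n \<le> B" if q: "q \<in> S"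
      proof -
        have "2 ^ multiplicity q n \<le> q ^ multiplicity q n"
          using S(2)[OF q] prime_ge_2_nat by (intro power_mono) auto
        also have "\<dots> \<le> n" using n0 by (intro dvd_imp_le multiplicity_dvd)
        also have "\<dots> \<le> b ^ (m + 1)" using m by simp
        also have "\<dots> \<le> (2 ^ b) ^ (m + 1)" by (intro power_mono) (simp_all add: less_imp_le)
        also have "\<dots> = 2 ^ B" by (simp only: B_def power_mult)
        finally show ?thesis by (rule power_le_imp_le_exp[rotated]) simp
      qed
      ultimately show ?thesis unfolding e_def by auto
    qed
    show "ln (real A) - ln (real D) + (\<Sum>q\<in>Q. e q * ln (real q)) \<noteq> 0" using \<Lambda>0 by (simp add: \<Lambda>_def)
    have "ln (real D) \<le> (B div V (Suc i) + 1) * ln b"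
    proof -
      have "real D \<le> real b ^ (B div V (Suc i) + 1)" using Du by (simp flip: of_nat_power del: power_Suc)
      then have "ln (real D) \<le> ln (real b ^ (B div V (Suc i) + 1))" using D0 b by (subst ln_le_cancel_iff) auto
      then show ?thesis using b by (simp add: ln_realpow del: power_Suc)
    qed
    also have "\<dots> \<le> (2 * (real B / V (Suc i))) * b"
    proof (intro mult_mono lnb)
      have "real (B div V (Suc i)) \<le> real B / V (Suc i)" by (rule of_nat_div_le_of_nat)
      moreover have "1 \<le> real B / V (Suc i)" using BV[of "Suc i"] i(1) Vpos[of "Suc i"] by (simp add: field_simps)
      ultimately show "real (B div V (Suc i) + 1) \<le> 2 * (real B / V (Suc i))" by simp
    qed auto
    also have "\<dots> = B * (2 * b / V (Suc i))" by simp
    also have "\<dots> \<le> B * (1 / real ((4 * V i) ^ P))"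
    proof (intro mult_left_mono)
      have "real (2 * b * (4 * V i) ^ P) \<le> V (Suc i)" using Yp by (simp only: of_nat_le_iff)
      then show "2 * b / V (Suc i) \<le> 1 / real ((4 * V i) ^ P)"
        using Yp0 Vpos[of "Suc i"] by (simp add: field_simps del: of_nat_power)
    qed simp
    finally show "ln (real D) \<le> B / real ((4 * V i) ^ (100 * (G + 1)))" by (simp add: P_def)
    define c where "c = 1 / (2::real) ^ V k"
    have c: "0 \<le> c" "c \<le> 1 / real ((4 * V i) ^ P)"
    proof -
      have "(4 * V i) ^ P \<le> V k" using Yp' Vmono[of "Suc i" k] i(1) by simp
      also have "\<dots> \<le> 2 ^ V k" by (simp add: less_imp_le)
      finally have "real ((4 * V i) ^ P) \<le> real (2 ^ V k)" by (simp only: of_nat_le_iff)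
      then have "real ((4 * V i) ^ P) \<le> 2 ^ V k" by simp
      then show "c \<le> 1 / real ((4 * V i) ^ P)" unfolding c_def using Yp0 by (intro divide_left_mono) auto
    qed (simp add: c_def)
    have "ln (real n powr (1 - c)) < ln (real sp)"
      using large n0 sp0 by (subst ln_less_cancel_iff) (auto simp: c_def sp_def)
    then have "(1 - c) * ln n < ln (real n) - ln (real A)"
      using n0 A0 sp0 arg_cong[OF nA, of "\<lambda>x. ln (real x)"] by (simp add: ln_powr ln_mult)
    then have "ln (real A) \<le> c * ln n" by (simp add: algebra_simps)
    also have "\<dots> \<le> c * B"
    proof (intro mult_left_mono c)
      have "real n \<le> real b ^ (m + 1)" using m(2) by (simp flip: of_nat_power del: power_Suc)
      then have "ln (real n) \<le> ln (real b ^ (m + 1))" using n0 b by (subst ln_le_cancel_iff) auto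
      also have "\<dots> = (m + 1) * ln b" using b by (simp add: ln_realpow del: power_Suc)
      also have "\<dots> \<le> real (m + 1) * real b" using lnb by (intro mult_left_mono) auto
      finally show "ln (real n) \<le> B" by (simp add: B_def algebra_simps)
    qed
    also have "\<dots> \<le> 1 / real ((4 * V i) ^ P) * B" using c by (intro mult_right_mono) auto
    finally show "ln (real A) \<le> B / real ((4 * V i) ^ (100 * (G + 1)))" by (simp add: P_def)
  qed
  then show False using upper \<Lambda>0 by simp
qed

section \<open>Effective computability\<close>

lemma total_recursive_comp1:
  assumes "total_recursive 1 F" and "\<And>a. F [a] = h a" and "total_recursive n g"
  shows "total_recursive n (\<lambda>xs. h (g xs))"
  using total_recursive.comp[of "[g]" F n] assms by simp

lemma total_recursive_comp2:
  assumes "total_recursive 2 F" and "\<And>a b. F [a, b] = h a b"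
    and "total_recursive n g1" and "total_recursive n g2"
  shows "total_recursive n (\<lambda>xs. h (g1 xs) (g2 xs))"
proof -
  have "total_recursive n (\<lambda>xs. F (map (\<lambda>g. g xs) [g1, g2]))"
    by (rule total_recursive.comp) (use assms in \<open>auto simp: numeral_2_eq_2\<close>)
  then show ?thesis using assms(2) by simp
qed

lemma total_recursive_Suc:
  "total_recursive n g \<Longrightarrow> total_recursive n (\<lambda>xs. Suc (g xs))"
  by (rule total_recursive_comp1[OF total_recursive.succ]) auto

lemma total_recursive_const: "total_recursive n (\<lambda>xs. c)"
  by (induction c) (auto intro: total_recursive.zero total_recursive_Suc)

text \<open>The recursion runs on the first argument of \<open>h\<close>, which is why powers and
  differences are obtained below from an \<open>h\<close> with swapped arguments.\<close>

lemma total_recursive_prec2: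
  assumes "total_recursive 1 f" and "total_recursive 3 g"
    and "\<And>a b. rec_nat (f [b]) (\<lambda>i r. g [i, r, b]) a = h a b"
    and "total_recursive n g1" and "total_recursive n g2"
  shows "total_recursive n (\<lambda>xs. h (g1 xs) (g2 xs))"
proof (rule total_recursive_comp2[OF _ _ assms(4,5)])
  show "total_recursive 2 (\<lambda>xs. rec_nat (f (tl xs)) (\<lambda>i r. g (i # r # tl xs)) (hd xs))"
    using total_recursive.prec[of 1 f g] assms(1,2) by (simp add: numeral_3_eq_3 numeral_2_eq_2)
qed (use assms(3) in simp)

lemma total_recursive_add:
  assumes "total_recursive n f" "total_recursive n g"
  shows "total_recursive n (\<lambda>xs. f xs + g xs)"
proof (rule total_recursive_prec2[of "\<lambda>xs. xs ! 0" "\<lambda>xs. Suc (xs ! 1)", OF _ _ _ assms])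
  show "rec_nat ([b] ! 0) (\<lambda>i r. Suc ([i, r, b] ! 1)) a = a + b" for a b :: nat
    by (induction a) auto
qed (auto intro!: total_recursive_Suc total_recursive.proj)

lemma total_recursive_mult:
  assumes "total_recursive n f" "total_recursive n g"
  shows "total_recursive n (\<lambda>xs. f xs * g xs)"
proof (rule total_recursive_prec2[of "\<lambda>xs. 0" "\<lambda>xs. xs ! 1 + xs ! 2", OF _ _ _ assms])
  show "rec_nat 0 (\<lambda>i r. [i, r, b] ! 1 + [i, r, b] ! 2) a = a * b" for a b :: nat
    by (induction a) auto
qed (auto intro!: total_recursive_add total_recursive.proj total_recursive.zero)

lemma total_recursive_power:
  assumes "total_recursive n f" "total_recursive n g"
  shows "total_recursive n (\<lambda>xs. f xs ^ g xs)"
proof (rule total_recursive_prec2[of "\<lambda>xs. 1" "\<lambda>xs. xs ! 1 * xs ! 2" "\<lambda>a b. b ^ a",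
      OF _ _ _ assms(2,1)])
  show "rec_nat 1 (\<lambda>i r. [i, r, b] ! 1 * [i, r, b] ! 2) a = b ^ a" for a b :: nat
    by (induction a) auto
qed (auto intro!: total_recursive_mult total_recursive.proj total_recursive_const)

lemma total_recursive_pred:
  assumes "total_recursive n f"
  shows "total_recursive n (\<lambda>xs. f xs - 1)"
proof (rule total_recursive_comp1[OF _ _ assms])
  \<comment> \<open>The recursion step returns its counter, which is the predecessor of the next
    argument.\<close>
  show "total_recursive 1 (\<lambda>xs. rec_nat ((\<lambda>_. 0) (tl xs)) (\<lambda>i r. (\<lambda>xs. xs ! 0) (i # r # tl xs)) (hd xs))"
    using total_recursive.prec[OF total_recursive.zero total_recursive.proj[of 0 "Suc (Suc 0)"]]
    by simp
  show "rec_nat ((\<lambda>_. 0) (tl [a])) (\<lambda>i r. (\<lambda>xs. xs ! 0) (i # r # tl [a])) (hd [a]) = a - 1" for a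
    by (cases a) auto
qed

lemma total_recursive_diff:
  assumes "total_recursive n f" "total_recursive n g"
  shows "total_recursive n (\<lambda>xs. f xs - g xs)"
proof (rule total_recursive_prec2[of "\<lambda>xs. xs ! 0" "\<lambda>xs. xs ! 1 - 1" "\<lambda>a b. b - a",
      OF _ _ _ assms(2,1)])
  show "rec_nat ([b] ! 0) (\<lambda>i r. [i, r, b] ! 1 - 1) a = b - a" for a b :: nat
    by (induction a) auto
qed (intro total_recursive_pred total_recursive.proj; simp)+

lemma total_recursive_scale:
  assumes "total_recursive n f" "total_recursive n g"
  shows "total_recursive n (\<lambda>xs. scale (f xs) (g xs))"
  unfolding scale_def
  by (intro total_recursive_power total_recursive_mult total_recursive_add total_recursive_const assms)

theorem theorem1p5:
  "\<exists>(c\<^sub>1 :: nat \<Rightarrow> nat \<Rightarrow> nat set \<Rightarrow> real) (j\<^sub>1 :: nat \<Rightarrow> nat \<Rightarrow> nat set \<Rightarrow> nat).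
     effectively_computable_real c\<^sub>1 \<and> effectively_computable_nat j\<^sub>1 \<and>
     (\<forall>b k S. b \<ge> 2 \<and> k \<ge> 2 \<and> finite S \<and> S \<noteq> {} \<and> (\<forall>q\<in>S. prime q) \<longrightarrow>
        c\<^sub>1 b k S > 0 \<and> j\<^sub>1 b k S > 0 \<and>
        (\<forall>j \<ge> j\<^sub>1 b k S.
           real (S_part S (u b k j)) \<le> real (u b k j) powr (1 - c\<^sub>1 b k S)))"
proof -
  define V where "V b k S = scale (b + set_encode S) k" for b k S
  have tr: "total_recursive n (\<lambda>xs. scale (xs ! 0 + xs ! 2) (xs ! 1))" if "n \<ge> 3" for n
    using that by (intro total_recursive_scale total_recursive_add total_recursive.proj) auto
  have "effectively_computable_real (\<lambda>b k S. 1 / 2 ^ V b k S)"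
    unfolding effectively_computable_real_def
  proof (intro exI conjI allI impI)
    show "total_recursive 4 (\<lambda>xs. 2 ^ (xs ! 3 - scale (xs ! 0 + xs ! 2) (xs ! 1)))"
      by (intro total_recursive_power total_recursive_diff total_recursive_const tr total_recursive.proj) auto
    show "total_recursive 4 (\<lambda>xs. 0)" by (rule total_recursive.zero)
    fix b k S n
    \<comment> \<open>For \<open>v \<le> n\<close> the approximation is exact. Otherwise truncated
      subtraction turns it into \<open>1 / 2 ^ n\<close>, and the true value lies between zero and
      that number.\<close>
    have *: "\<bar>1 / 2 ^ v - 2 ^ (n - v) / 2 ^ n\<bar> \<le> 1 / (2::real) ^ n" for v
    proof (cases "v \<le> n")
      case True
      then show ?thesis by (simp add: power_diff)
    next
      case False
      then have "1 / 2 ^ v \<le> 1 / (2::real) ^ n" by (intro divide_left_mono power_increasing) auto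
      moreover have "0 \<le> 1 / (2::real) ^ v" by simp
      ultimately show ?thesis using False by simp
    qed
    then show "\<bar>1 / 2 ^ V b k S - (real (2 ^ ([b, k, set_encode S, n] ! 3
        - scale ([b, k, set_encode S, n] ! 0 + [b, k, set_encode S, n] ! 2) ([b, k, set_encode S, n] ! 1)))
        - real 0) / 2 ^ n\<bar> \<le> 1 / 2 ^ n"
      by (simp add: V_def numeral_2_eq_2 numeral_3_eq_3)
  qed
  moreover have "effectively_computable_nat (\<lambda>b k S. b ^ V b k S + 1)"
    unfolding effectively_computable_nat_def
  proof (intro exI conjI allI impI)
    show "total_recursive 3 (\<lambda>xs. (xs ! 0) ^ scale (xs ! 0 + xs ! 2) (xs ! 1) + 1)"
      by (intro total_recursive_power total_recursive_add total_recursive_const tr total_recursive.proj) auto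
  qed (simp add: V_def numeral_2_eq_2)
  moreover have "real (S_part S (u b k j)) \<le> real (u b k j) powr (1 - 1 / 2 ^ V b k S)"
    if *: "b \<ge> 2" "k \<ge> 2" "finite S" "\<forall>q\<in>S. prime q" and j: "b ^ V b k S + 1 \<le> j" for b k S j
    unfolding V_def
  proof (rule S_part_sparse_le)
    have inf: "infinite (sparse_set b k)" using * by (intro infinite_sparse_set)
    show "u b k j \<in> sparse_set b k" unfolding u_def by (rule enumerate_in_set[OF inf])
    \<comment> \<open>The enumeration starts at 0, so the \<open>j\<close>-th term is only known to
      be at least \<open>j - 1\<close>; hence the \<open>+ 1\<close> in the threshold.\<close>
    have "b ^ V b k S \<le> j - 1" using j by simp
    also have "\<dots> \<le> u b k j" unfolding u_def by (rule le_enumerate[OF inf])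
    finally show "b ^ scale (b + set_encode S) k \<le> u b k j" by (simp add: V_def)
  qed (use * in auto)
  ultimately show ?thesis
    by (intro exI[of _ "\<lambda>b k S. 1 / 2 ^ V b k S"] exI[of _ "\<lambda>b k S. b ^ V b k S + 1"]) auto
qed

end
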